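(* Let $G$ be a subgroup of $\mathrm{Homeo}_+(\mathbb{R})$ without crossed elements (i.e. no two elements of $G$ are crossed). Then the following are equivalent: (1) there exists a nonzero $G$-invariant Radon measure on $\mathbb{R}$; (2) there exists a nonempty closed minimal set for $G$ in $\mathbb{R}$; (3) there does not exist any infinite tower $\{(I_i,f_i)\}_{i=1}^\infty$ with $f_i\in G$ for all $i$ such that $\bigcup_{i=1}^\infty I_i=\mathbb{R}$.
   Context: $\mathrm{Homeo}_+(\mathbb{R})$ is the group of orientation preserving homeomorphisms of $\mathbb{R}$. For a homeomorphism $g$, $\mathrm{Fix}(g)$ is its set of fixed points. $G$ is not assumed finitely generated or countable. Crossed elements: $f,g\in\mathrm{Homeo}_+(\mathbb{R})$ are crossed if there is an interval $(a,b)$, where $a=-\infty$ or $b=+\infty$ is allowed, such that for one of the two, say $f$, $\mathrm{Fix}(f)\cap[a,b]=\{a,b\}$, while the other one, $g$, sends either $a$ or $b$ into $(a,b)$. (Homeomorphisms in $\mathrm{Homeo}_+(\mathbb{R})$ are regarded as fixing $\pm\infty$.) Radon measure: a Borel measure on $\mathbb{R}$ that is finite on every compact set. It is $G$-invariant if $\mu(g(E))=\mu(E)$ for all $g\in G$ and Borel $E$. A minimal closed set for $G$ is a nonempty $G$-invariant closed subset of $\mathbb{R}$ that is minimal with respect to inclusion among all nonempty $G$-invariant closed subsets. Infinite tower: a sequence of pairs $\{(I_i,f_i)\}_{i=1}^\infty$ where the $I_i=[a_i,b_i]$ ($-\infty<a_i<b_i<+\infty$) are closed intervals with $I_1\subsetneq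 I_2\subsetneq\cdots$ and the $f_i$ are orientation preserving homeomorphisms of $\mathbb{R}$ with $\mathrm{Fix}(f_i)\cap I_i=\mathrm{End}(I_i)$ for each $i$, where $\mathrm{End}(I_i)=\{a_i,b_i\}$ is the set of endpoints of $I_i$. *)

theory Defs
  imports "HOL-Analysis.Analysis" "HOL-Algebra.Group"
begin

definition homeo_plus :: "(real \<Rightarrow> real) monoid" where
  "homeo_plus =
     \<lparr>carrier = {f. strict_mono f \<and> (\<exists>g. homeomorphism UNIV UNIV f g)},
      mult = (\<circ>),
      one = id\<rparr>"

lemma group_homeo_plus: "group homeo_plus"
proof (rule groupI)
  fix f assume "f \<in> carrier homeo_plus"
  then obtain g where sm: "strict_mono f" and h: "homeomorphism UNIV UNIV f g"
    unfolding homeo_plus_def by auto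
  have fg: "f (g x) = x" "g (f x) = x" for x
    using h by (simp_all add: homeomorphism_def)
  have "strict_mono g"
  proof (rule strict_monoI)
    fix x y :: real assume "x < y"
    then show "g x < g y"
      using strict_mono_less[OF sm, of "g x" "g y"] by (simp add: fg)
  qed
  moreover have "homeomorphism UNIV UNIV g f"
    using h homeomorphism_symD by blast
  ultimately have "g \<in> carrier homeo_plus"
    unfolding homeo_plus_def by auto
  moreover have "g \<otimes>\<^bsub>homeo_plus\<^esub> f = \<one>\<^bsub>homeo_plus\<^esub>"
    by (simp add: homeo_plus_def fun_eq_iff fg)
  ultimately show "\<exists>k\<in>carrier homeo_plus. k \<otimes>\<^bsub>homeo_plus\<^esub> f = \<one>\<^bsub>homeo_plus\<^esub>"
    by blast
next
  fix f k assume "f \<in> carrier homeo_plus" "k \<in> carrier homeo_plus"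
  then obtain f' k' where "strict_mono f" "homeomorphism UNIV UNIV f f'"
      "strict_mono k" "homeomorphism UNIV UNIV k k'"
    unfolding homeo_plus_def by auto
  then have "strict_mono (f \<circ> k)" "homeomorphism UNIV UNIV (f \<circ> k) (k' \<circ> f')"
    using homeomorphism_compose by (auto simp: strict_mono_def)
  then show "f \<otimes>\<^bsub>homeo_plus\<^esub> k \<in> carrier homeo_plus"
    unfolding homeo_plus_def by auto
next
  have "homeomorphism UNIV UNIV (id :: real \<Rightarrow> real) id" "strict_mono (id :: real \<Rightarrow> real)"
    by (simp_all add: homeomorphism_def strict_mono_def)
  then show "\<one>\<^bsub>homeo_plus\<^esub> \<in> carrier homeo_plus"
    unfolding homeo_plus_def by auto
qed (simp_all add: homeo_plus_def o_assoc)

definition Fix :: "('a \<Rightarrow> 'a) \<Rightarrow> 'a set" where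
  "Fix f = {x. f x = x}"

text \<open>Orientation preserving homeomorphisms of the line act on the extended line,
  fixing both points at infinity.\<close>

definition extend_ereal :: "(real \<Rightarrow> real) \<Rightarrow> ereal \<Rightarrow> ereal" where
  "extend_ereal f x = (case x of ereal r \<Rightarrow> ereal (f r) | PInfty \<Rightarrow> \<infinity> | MInfty \<Rightarrow> -\<infinity>)"

definition crosses :: "(real \<Rightarrow> real) \<Rightarrow> (real \<Rightarrow> real) \<Rightarrow> ereal \<Rightarrow> ereal \<Rightarrow> bool" where
  "crosses f g a b \<longleftrightarrow>
     Fix (extend_ereal f) \<inter> {a..b} = {a, b} \<and>
     (extend_ereal g a \<in> {a<..<b} \<or> extend_ereal g b \<in> {a<..<b})"

definition crossed :: "(real \<Rightarrow> real) \<Rightarrow> (real \<Rightarrow> real) \<Rightarrow> bool" where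
  "crossed f g \<longleftrightarrow> (\<exists>a b. a < b \<and> (crosses f g a b \<or> crosses g f a b))"

definition radon_measure :: "real measure \<Rightarrow> bool" where
  "radon_measure \<mu> \<longleftrightarrow>
     sets \<mu> = sets borel \<and> (\<forall>K. compact K \<longrightarrow> emeasure \<mu> K < \<infinity>)"

definition invariant_measure :: "(real \<Rightarrow> real) set \<Rightarrow> real measure \<Rightarrow> bool" where
  "invariant_measure G \<mu> \<longleftrightarrow>
     (\<forall>g\<in>G. \<forall>E\<in>sets borel. emeasure \<mu> (g ` E) = emeasure \<mu> E)"

definition invariant_set :: "(real \<Rightarrow> real) set \<Rightarrow> real set \<Rightarrow> bool" where
  "invariant_set G A \<longleftrightarrow> (\<forall>g\<in>G. g ` A = A)"

definition minimal_closed_set :: "(real \<Rightarrow> real) set \<Rightarrow> real set \<Rightarrow> bool" where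
  "minimal_closed_set G A \<longleftrightarrow>
     A \<noteq> {} \<and> closed A \<and> invariant_set G A \<and>
     (\<forall>B. B \<noteq> {} \<and> closed B \<and> invariant_set G B \<and> B \<subseteq> A \<longrightarrow> B = A)"

text \<open>The interval \<open>I\<^sub>i\<close> of a tower is given by its endpoints \<open>a i\<close> and \<open>b i\<close>;
  the indices start from 0.\<close>

definition infinite_tower ::
    "(nat \<Rightarrow> real) \<Rightarrow> (nat \<Rightarrow> real) \<Rightarrow> (nat \<Rightarrow> real \<Rightarrow> real) \<Rightarrow> bool" where
  "infinite_tower a b f \<longleftrightarrow>
     (\<forall>i. a i < b i \<and>
          {a i..b i} \<subset> {a (Suc i)..b (Suc i)} \<and>
          f i \<in> carrier homeo_plus \<and>
          Fix (f i) \<inter> {a i..b i} = {a i, b i})"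

end

theory Submission
  imports Defs
begin

text \<open>
  (1) implies (3): if \<open>f\<close> fixes \<open>a\<close> and has no fixed point in \<open>(a, c]\<close>, then up to replacing
  \<open>f\<close> by its inverse the sets \<open>(a, f\<^sup>n c]\<close> decrease to the empty set while all having the same finite
  measure, so \<open>(a, c]\<close> is null. A tower exhausting the line would make the whole line null.

  (3) implies (2): if a compact set meets every orbit, Zorn's lemma gives a minimal set. Otherwise
  there is no global fixed point and the fixed point set of every element is unbounded on both
  sides. Two overlapping intervals without fixed points of \<open>f\<close> and \<open>h\<close>, respectively, have a
  union without fixed points of \<open>f\<close> or of \<open>h\<close>, since \<open>f\<close> and \<open>h\<close> would be crossed otherwise. Hence every
  compact interval lies in a bounded component of the complement of some \<open>Fix f\<close>, and such components form the tower.

  (2) implies (1): let \<open>x\<close> be a point of the minimal set \<open>A\<close>. An element with a fixed point is the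
  identity on \<open>A\<close>: otherwise an endpoint of one of its components lies in \<open>A\<close>, and its
  dense orbit enters the component, which gives a crossing. So comparing \<open>h x\<close> with \<open>k x\<close> defines a bi-invariant
  Archimedean order, and Hoelder's argument yields a monotone homomorphism \<open>\<tau>\<close> to the reals. The
  function \<open>F y = inf {\<tau> h | h x > y}\<close> satisfies \<open>F (k y) = F y + \<tau> k\<close>, so its
  Stieltjes measure is invariant.
\<close>

section \<open>Hoelder's theorem for bi-invariant Archimedean orders\<close>

text \<open>A preorder only, because two homeomorphisms may agree at the base point used for
  comparison. The axioms are self-dual, so the locale also applies to the reversed relation.\<close>

locale preordered_monoid = monoid G for G (structure) +
  fixes le :: "'a \<Rightarrow> 'a \<Rightarrow> bool" (infix \<open>\<preceq>\<close> 50)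
  assumes le_refl: "a \<in> carrier G \<Longrightarrow> a \<preceq> a"
    and le_trans: "\<lbrakk>a \<in> carrier G; b \<in> carrier G; c \<in> carrier G; a \<preceq> b; b \<preceq> c\<rbrakk> \<Longrightarrow> a \<preceq> c"
    and le_mult: "\<lbrakk>a \<in> carrier G; b \<in> carrier G; c \<in> carrier G; d \<in> carrier G; a \<preceq> b; c \<preceq> d\<rbrakk>
                   \<Longrightarrow> a \<otimes> c \<preceq> b \<otimes> d"
begin

lemma le_mult_left: "\<lbrakk>a \<in> carrier G; b \<in> carrier G; c \<in> carrier G; a \<preceq> b\<rbrakk> \<Longrightarrow> c \<otimes> a \<preceq> c \<otimes> b"
  and le_mult_right: "\<lbrakk>a \<in> carrier G; b \<in> carrier G; c \<in> carrier G; a \<preceq> b\<rbrakk> \<Longrightarrow> a \<otimes> c \<preceq> b \<otimes> c"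
  using le_mult le_refl by blast+

lemma le_pow:
  assumes "a \<in> carrier G" "b \<in> carrier G" "a \<preceq> b"
  shows "a [^] (n::nat) \<preceq> b [^] n"
  by (induction n) (use assms in \<open>auto intro: le_refl le_mult\<close>)

text \<open>The factor \<open>k\<close> moves left past the \<open>n\<close> copies of
  \<open>h\<close> one at a time, each move by \<open>le\<close>.\<close>

lemma pow_mult_le_mult_pow:
  assumes h: "h \<in> carrier G" and k: "k \<in> carrier G" and le: "h \<otimes> k \<preceq> k \<otimes> h"
  shows "h [^] (n::nat) \<otimes> k \<preceq> k \<otimes> h [^] n"
proof (induction n)
  case 0
  then show ?case using k by (auto intro: le_refl)
next
  case (Suc n)
  have "h [^] n \<otimes> (h \<otimes> k) \<preceq> h [^] n \<otimes> (k \<otimes> h)"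
    using h k le by (intro le_mult_left le_mult_right) auto
  moreover have "(h [^] n \<otimes> k) \<otimes> h \<preceq> (k \<otimes> h [^] n) \<otimes> h"
    using h k Suc by (intro le_mult_left le_mult_right) auto
  ultimately show ?case
    using h k le_trans[of "h [^] n \<otimes> (h \<otimes> k)" "h [^] n \<otimes> (k \<otimes> h)" "(k \<otimes> h [^] n) \<otimes> h"]
    by (simp add: m_assoc)
qed

lemma mult_pow_le_pow_mult:
  assumes h: "h \<in> carrier G" and k: "k \<in> carrier G" and le: "h \<otimes> k \<preceq> k \<otimes> h"
  shows "h \<otimes> k [^] (n::nat) \<preceq> k [^] n \<otimes> h"
proof (induction n)
  case 0
  then show ?case using h by (auto intro: le_refl)
next
  case (Suc n)
  have "k [^] n \<otimes> (h \<otimes> k) \<preceq> k [^] n \<otimes> (k \<otimes> h)"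
    using h k le by (intro le_mult_left le_mult_right) auto
  moreover have "(h \<otimes> k [^] n) \<otimes> k \<preceq> (k [^] n \<otimes> h) \<otimes> k"
    using h k Suc by (intro le_mult_left le_mult_right) auto
  ultimately show ?case
    using h k le_trans[of "(h \<otimes> k [^] n) \<otimes> k" "k [^] n \<otimes> (h \<otimes> k)" "k [^] n \<otimes> (k \<otimes> h)"]
    by (simp add: m_assoc)
qed

text \<open>In the induction step the extra \<open>h\<close> moves right past
  \<open>k [^] n\<close>, after which \<open>h \<otimes> k\<close> splits off at the end.\<close>

lemma pow_mult_pow_le:
  assumes h: "h \<in> carrier G" and k: "k \<in> carrier G" and le: "h \<otimes> k \<preceq> k \<otimes> h"
  shows "h [^] (n::nat) \<otimes> k [^] n \<preceq> (h \<otimes> k) [^] n"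
proof (induction n)
  case 0
  then show ?case by (auto intro: le_refl)
next
  case (Suc n)
  have "h [^] n \<otimes> (h \<otimes> k [^] n) \<otimes> k \<preceq> h [^] n \<otimes> (k [^] n \<otimes> h) \<otimes> k"
    using h k mult_pow_le_pow_mult[OF assms] by (intro le_mult_left le_mult_right) auto
  moreover have "(h [^] n \<otimes> k [^] n) \<otimes> (h \<otimes> k) \<preceq> (h \<otimes> k) [^] n \<otimes> (h \<otimes> k)"
    using h k Suc by (intro le_mult_left le_mult_right) auto
  ultimately show ?case
    using h k le_trans[of "h [^] n \<otimes> (h \<otimes> k [^] n) \<otimes> k" "(h [^] n \<otimes> k [^] n) \<otimes> (h \<otimes> k)"
        "(h \<otimes> k) [^] n \<otimes> (h \<otimes> k)"]
    by (simp add: m_assoc)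
qed

text \<open>In the induction step the last \<open>k\<close> moves left past all \<open>n + 1\<close>
  copies of \<open>h\<close> and joins \<open>k [^] n\<close>.\<close>

lemma pow_le_pow_mult_pow:
  assumes h: "h \<in> carrier G" and k: "k \<in> carrier G" and le: "h \<otimes> k \<preceq> k \<otimes> h"
  shows "(h \<otimes> k) [^] (n::nat) \<preceq> k [^] n \<otimes> h [^] n"
proof (induction n)
  case 0
  then show ?case by (auto intro: le_refl)
next
  case (Suc n)
  have "k [^] n \<otimes> (h [^] Suc n \<otimes> k) \<preceq> k [^] n \<otimes> (k \<otimes> h [^] Suc n)"
    using h k pow_mult_le_mult_pow[OF assms, of "Suc n"] by (intro le_mult_left le_mult_right) auto
  moreover have "(h \<otimes> k) [^] n \<otimes> (h \<otimes> k) \<preceq> (k [^] n \<otimes> h [^] n) \<otimes> (h \<otimes> k)"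
    using h k Suc by (intro le_mult_left le_mult_right) auto
  ultimately show ?case
    using h k le_trans[of "(h \<otimes> k) [^] n \<otimes> (h \<otimes> k)" "(k [^] n \<otimes> h [^] n) \<otimes> (h \<otimes> k)"
        "k [^] n \<otimes> (k \<otimes> h [^] Suc n)"]
    by (simp add: m_assoc)
qed

end

section \<open>Integer levels relative to the unit \<open>g\<close>, and Hoelder's
  homomorphism\<close>

locale archimedean_group = group G + preordered_monoid G le
  for G (structure) and le :: "'a \<Rightarrow> 'a \<Rightarrow> bool" (infix \<open>\<preceq>\<close> 50) +
  fixes g
  assumes le_total: "\<lbrakk>a \<in> carrier G; b \<in> carrier G\<rbrakk> \<Longrightarrow> a \<preceq> b \<or> b \<preceq> a"
    and g_closed: "g \<in> carrier G"
    and g_pos: "\<not> g \<preceq> \<one>"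
    and archimedean: "h \<in> carrier G \<Longrightarrow> \<exists>n::nat. h \<preceq> g [^] n"
begin

lemma le_mult_cancel_right:
  assumes "a \<in> carrier G" "b \<in> carrier G" "c \<in> carrier G" "a \<otimes> c \<preceq> b \<otimes> c"
  shows "a \<preceq> b"
  using le_mult[of "a \<otimes> c" "b \<otimes> c" "inv c" "inv c"] assms by (simp add: le_refl m_assoc)

text \<open>Nonnegative powers of \<open>g\<close> lie above \<open>\<one>\<close>, which gives
  monotonicity. A reversed inequality would cancel down to \<open>g \<preceq> \<one>\<close>,
  against \<open>g_pos\<close>.\<close>

lemma g_int_pow_le_iff: "g [^] (i::int) \<preceq> g [^] (j::int) \<longleftrightarrow> i \<le> j"
proof -
  have one_le: "\<one> \<preceq> g [^] n" for n :: nat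
    using le_pow[of \<one> g n] g_closed g_pos le_total[of g \<one>] by auto
  have mono: "g [^] i \<preceq> g [^] j" if "i \<le> j" for i j :: int
  proof -
    have "g [^] i \<otimes> \<one> \<preceq> g [^] i \<otimes> g [^] nat (j - i)"
      using g_closed one_le by (intro le_mult_left le_mult_right) auto
    moreover have "g [^] i \<otimes> g [^] nat (j - i) = g [^] j"
      using that g_closed by (simp flip: int_pow_int int_pow_mult)
    ultimately show ?thesis using g_closed by simp
  qed
  have "i \<le> j" if "g [^] i \<preceq> g [^] j"
  proof (rule ccontr)
    assume "\<not> i \<le> j"
    then have "g [^] (1 + j) \<preceq> g [^] i"
      by (intro mono) auto
    then have "g [^] (1 + j) \<preceq> g [^] j"
      using le_trans[OF _ _ _ _ that] g_closed by blast
    then have "g \<otimes> g [^] j \<preceq> \<one> \<otimes> g [^] j"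
      using g_closed by (simp add: int_pow_mult)
    then show False
      using le_mult_cancel_right[of g \<one> "g [^] j"] g_closed g_pos by auto
  qed
  with mono show ?thesis by blast
qed

lemma ex_level:
  assumes h: "h \<in> carrier G"
  shows "\<exists>n::int. \<forall>i::int. g [^] i \<preceq> h \<longleftrightarrow> i \<le> n"
proof -
  obtain m :: nat where "inv h \<preceq> g [^] m"
    using archimedean h by blast
  \<comment> \<open>The Archimedean axiom bounds only from above; applied to \<open>inv h\<close> it
    yields a lower bound for \<open>h\<close>.\<close>
  then have "(h \<otimes> inv h) \<otimes> inv (g [^] m) \<preceq> (h \<otimes> g [^] m) \<otimes> inv (g [^] m)"
    using h g_closed by (intro le_mult_left le_mult_right) auto
  then have low: "g [^] (- int m) \<preceq> h"
    using h g_closed by (simp add: m_assoc int_pow_neg int_pow_int)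
  obtain k :: nat where k: "h \<preceq> g [^] (int k)"
    using archimedean h by (auto simp: int_pow_int)
  have "\<not> g [^] (- int m + int (m + k + 1)) \<preceq> h"
  proof
    assume "g [^] (- int m + int (m + k + 1)) \<preceq> h"
    then have "g [^] (- int m + int (m + k + 1)) \<preceq> g [^] (int k)"
      using k le_trans h g_closed by blast
    then show False by (simp add: g_int_pow_le_iff)
  qed
  \<comment> \<open>Exponents are counted upward from \<open>- int m\<close>, so that a least
    failing one exists. The level is the exponent just before it; \<open>low\<close> excludes
    \<open>j = 0\<close>.\<close>
  then obtain j where j: "\<not> g [^] (- int m + int j) \<preceq> h" "\<And>j'. j' < j \<Longrightarrow> g [^] (- int m + int j') \<preceq> h"
    using exists_least_iff[of "\<lambda>j. \<not> g [^] (- int m + int j) \<preceq> h"] by blast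
  have "j \<noteq> 0"
    using j(1) low by (cases "j = 0") auto
  have "g [^] i \<preceq> h \<longleftrightarrow> i \<le> - int m + int j - 1" for i :: int
  proof
    assume i: "g [^] i \<preceq> h"
    show "i \<le> - int m + int j - 1"
    proof (rule ccontr)
      assume "\<not> ?thesis"
      then have "g [^] (- int m + int j) \<preceq> g [^] i"
        by (simp add: g_int_pow_le_iff)
      then show False
        using j(1) i le_trans h g_closed by blast
    qed
  next
    assume "i \<le> - int m + int j - 1"
    then have "g [^] i \<preceq> g [^] (- int m + int (j - 1))"
      using \<open>j \<noteq> 0\<close> by (simp add: g_int_pow_le_iff)
    moreover have "g [^] (- int m + int (j - 1)) \<preceq> h"
      using j(2)[of "j - 1", OF _] \<open>j \<noteq> 0\<close> by simp_all
    ultimately show "g [^] i \<preceq> h"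
      using le_trans h g_closed by blast
  qed
  then show ?thesis by blast
qed

text \<open>The integer part of \<open>h\<close> measured in units of \<open>g\<close>.\<close>

definition level :: "'a \<Rightarrow> int" where
  "level h = (SOME n. \<forall>i::int. g [^] i \<preceq> h \<longleftrightarrow> i \<le> n)"

lemma le_level_iff: "h \<in> carrier G \<Longrightarrow> i \<le> level h \<longleftrightarrow> g [^] i \<preceq> h"
  using someI_ex[OF ex_level[of h]] unfolding level_def by blast

lemma level_mono:
  assumes "h \<in> carrier G" "k \<in> carrier G" "h \<preceq> k"
  shows "level h \<le> level k"
proof -
  have "g [^] level h \<preceq> h" using assms le_level_iff by blast
  then have "g [^] level h \<preceq> k" using assms le_trans g_closed by blast
  then show ?thesis using assms le_level_iff by blast
qed

lemma level_mult_ge: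
  assumes "h \<in> carrier G" "k \<in> carrier G"
  shows "level h + level k \<le> level (h \<otimes> k)"
proof -
  have "g [^] level h \<preceq> h" "g [^] level k \<preceq> k" using assms le_level_iff by blast+
  then have "g [^] level h \<otimes> g [^] level k \<preceq> h \<otimes> k"
    using assms g_closed by (intro le_mult) auto
  then show ?thesis
    using assms g_closed le_level_iff by (simp add: int_pow_mult)
qed

text \<open>As for integer parts, rounding costs at most one: if the level of the product reached
  the sum of the two next integers, the power of \<open>g\<close> above \<open>k\<close> could be
  cancelled on the right, leaving \<open>h\<close> above its own next power.\<close>

lemma level_mult_le:
  assumes h: "h \<in> carrier G" and k: "k \<in> carrier G"
  shows "level (h \<otimes> k) \<le> level h + level k + 1"
proof (rule ccontr)
  let ?a = "g [^] (level h + 1)" and ?b = "g [^] (level k + 1)"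
  have a: "\<not> ?a \<preceq> h" and "\<not> ?b \<preceq> k"
    using le_level_iff[OF h, of "level h + 1"] le_level_iff[OF k, of "level k + 1"] by auto
  then have "k \<preceq> ?b"
    using le_total[of k ?b] k g_closed by auto
  then have 1: "h \<otimes> k \<preceq> h \<otimes> ?b"
    using h k g_closed by (intro le_mult_left le_mult_right) auto
  assume "\<not> ?thesis"
  then have "(level h + 1) + (level k + 1) \<le> level (h \<otimes> k)"
    by simp
  then have "?a \<otimes> ?b \<preceq> h \<otimes> k"
    using le_level_iff[of "h \<otimes> k"] h k g_closed by (metis int_pow_mult m_closed)
  then have "?a \<otimes> ?b \<preceq> h \<otimes> ?b"
    using 1 le_trans[of "?a \<otimes> ?b" "h \<otimes> k" "h \<otimes> ?b"] h k g_closed by blast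
  then show False
    using a le_mult_cancel_right h g_closed by blast
qed

lemma level_g_pow: "level (g [^] (n::nat)) = int n"
proof -
  have "i \<le> level (g [^] n) \<longleftrightarrow> i \<le> int n" for i
    using le_level_iff[of "g [^] n" i] g_int_pow_le_iff[of i "int n"] g_closed
    by (simp add: int_pow_int)
  then show ?thesis by (meson order.antisym order.refl)
qed

text \<open>Whichever of \<open>h \<otimes> k\<close> and \<open>k \<otimes> h\<close> is smaller, \<open>(h \<otimes> k)\<^sup>n\<close> lies between the two products of
  \<open>h\<^sup>n\<close> and \<open>k\<^sup>n\<close>; this replaces commutativity.\<close>

lemma level_mult_pow:
  assumes h: "h \<in> carrier G" and k: "k \<in> carrier G"
  shows "level (h [^] n) + level (k [^] n) \<le> level ((h \<otimes> k) [^] (n::nat))"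
    and "level ((h \<otimes> k) [^] (n::nat)) \<le> level (h [^] n) + level (k [^] n) + 1"
proof -
  \<comment> \<open>The reversed order supplies the same power inequalities, with directions
    exchanged, in the case \<open>k \<otimes> h \<preceq> h \<otimes> k\<close>.\<close>
  interpret op: preordered_monoid G "\<lambda>a b. b \<preceq> a"
    by unfold_locales (auto intro: le_refl le_trans le_mult)
  have "(h [^] n \<otimes> k [^] n \<preceq> (h \<otimes> k) [^] n \<and> (h \<otimes> k) [^] n \<preceq> k [^] n \<otimes> h [^] n) \<or>
        (k [^] n \<otimes> h [^] n \<preceq> (h \<otimes> k) [^] n \<and> (h \<otimes> k) [^] n \<preceq> h [^] n \<otimes> k [^] n)"
    using le_total[of "h \<otimes> k" "k \<otimes> h"] h k pow_mult_pow_le[of h k n] pow_le_pow_mult_pow[of h k n]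
      op.pow_mult_pow_le[of h k n] op.pow_le_pow_mult_pow[of h k n] by auto
  then have "(level (h [^] n \<otimes> k [^] n) \<le> level ((h \<otimes> k) [^] n) \<and>
         level ((h \<otimes> k) [^] n) \<le> level (k [^] n \<otimes> h [^] n)) \<or>
        (level (k [^] n \<otimes> h [^] n) \<le> level ((h \<otimes> k) [^] n) \<and>
         level ((h \<otimes> k) [^] n) \<le> level (h [^] n \<otimes> k [^] n))"
    using h k by (auto intro: level_mono)
  then show "level (h [^] n) + level (k [^] n) \<le> level ((h \<otimes> k) [^] n)"
    and "level ((h \<otimes> k) [^] n) \<le> level (h [^] n) + level (k [^] n) + 1"
    using level_mult_ge[of "h [^] n" "k [^] n"] level_mult_ge[of "k [^] n" "h [^] n"]
      level_mult_le[of "h [^] n" "k [^] n"] level_mult_le[of "k [^] n" "h [^] n"] h k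
    by auto
qed

text \<open>Along the powers of two, superadditivity of \<open>level\<close> makes the averages monotone, so that
  no version of Fekete's lemma is needed.\<close>

definition approx :: "'a \<Rightarrow> nat \<Rightarrow> real" where
  "approx h n = level (h [^] ((2::nat) ^ n)) / 2 ^ n"

lemma convergent_approx:
  assumes h: "h \<in> carrier G"
  shows "convergent (approx h)"
proof -
  have sq: "h [^] ((2::nat) ^ Suc n) = h [^] ((2::nat) ^ n) \<otimes> h [^] ((2::nat) ^ n)" for n
    using h by (simp add: nat_pow_mult mult_2)
  have up: "approx h n \<le> approx h (Suc n)" for n
    using level_mult_ge[of "h [^] ((2::nat) ^ n)" "h [^] ((2::nat) ^ n)"] h
    unfolding approx_def sq by (simp add: field_simps)
  \<comment> \<open>The defect of at most one in \<open>level_mult_le\<close> makes the averages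
    decrease once \<open>1 / 2 ^ n\<close> is added. This bounds the increasing sequence
    \<open>approx h\<close>.\<close>
  have down: "approx h (Suc n) + 1 / 2 ^ Suc n \<le> approx h n + 1 / 2 ^ n" for n
  proof -
    let ?m = "h [^] ((2::nat) ^ n)"
    have "real_of_int (level (?m \<otimes> ?m)) \<le> of_int (level ?m + level ?m + 1)"
      using level_mult_le[of ?m ?m] h by (simp only: of_int_le_iff nat_pow_closed)
    then have "(level (?m \<otimes> ?m) + 1) / (2 * 2 ^ n) \<le> (2 * (level ?m + 1)) / (2 * (2::real) ^ n)"
      by (intro divide_right_mono) auto
    then show ?thesis
      unfolding approx_def sq by (simp add: add_divide_distrib)
  qed
  have "approx h n + 1 / 2 ^ n \<le> approx h 0 + 1" for n
    using lift_Suc_antimono_le[of "\<lambda>n. approx h n + 1 / 2 ^ n" 0 n] down by simp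
  moreover have "0 \<le> 1 / (2::real) ^ n" for n by simp
  ultimately have "approx h n \<le> approx h 0 + 1" for n
    by (meson add_increasing2 dual_order.trans order.refl)
  then show ?thesis
    using incseq_convergent[of "approx h"] up incseq_SucI convergentI by metis
qed

theorem ex_monotone_hom_to_real:
  shows "\<exists>\<tau>::'a \<Rightarrow> real. \<tau> g = 1 \<and>
    (\<forall>h\<in>carrier G. \<forall>k\<in>carrier G. \<tau> (h \<otimes> k) = \<tau> h + \<tau> k \<and> (h \<preceq> k \<longrightarrow> \<tau> h \<le> \<tau> k))"
proof -
  define \<tau> where "\<tau> h = lim (approx h)" for h
  have lim: "approx h \<longlonglongrightarrow> \<tau> h" if "h \<in> carrier G" for h
    using convergent_approx[OF that] by (simp add: \<tau>_def convergent_LIMSEQ_iff)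
  have "approx g = (\<lambda>n. 1)"
    by (simp add: approx_def level_g_pow fun_eq_iff)
  then have "\<tau> g = 1"
    using lim[OF g_closed] by (simp add: LIMSEQ_const_iff)
  moreover have "\<tau> (h \<otimes> k) = \<tau> h + \<tau> k" if h: "h \<in> carrier G" and k: "k \<in> carrier G" for h k
  proof -
    \<comment> \<open>The additivity defect at exponent \<open>2 ^ n\<close>. It is 0 or 1, so it
      vanishes after division by \<open>2 ^ n\<close>.\<close>
    define d where "d n = level ((h \<otimes> k) [^] ((2::nat) ^ n)) - level (h [^] ((2::nat) ^ n))
                            - level (k [^] ((2::nat) ^ n))" for n
    have d: "0 \<le> d n" "d n \<le> 1" for n
      using level_mult_pow[OF h k, of "2 ^ n"] by (auto simp: d_def)
    have "approx (h \<otimes> k) n - approx h n - approx k n = d n / 2 ^ n" for n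
      by (simp add: approx_def d_def diff_divide_distrib)
    moreover have "(\<lambda>n. d n / 2 ^ n) \<longlonglongrightarrow> 0"
    proof (rule tendsto_sandwich[of "\<lambda>_. 0" _ _ "\<lambda>n. 1 / 2 ^ n"])
      show "\<forall>\<^sub>F n in sequentially. 0 \<le> d n / 2 ^ n"
        using d by (intro always_eventually allI) simp
      show "\<forall>\<^sub>F n in sequentially. d n / 2 ^ n \<le> 1 / 2 ^ n"
        using d by (intro always_eventually allI divide_right_mono) auto
      show "(\<lambda>n. 1 / 2 ^ n :: real) \<longlonglongrightarrow> 0"
        using LIMSEQ_realpow_zero[of "1 / 2 :: real"] by (simp add: power_one_over)
    qed simp
    ultimately have "(\<lambda>n. approx (h \<otimes> k) n - approx h n - approx k n) \<longlonglongrightarrow> 0"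
      by presburger
    moreover have "(\<lambda>n. approx (h \<otimes> k) n - approx h n - approx k n) \<longlonglongrightarrow> \<tau> (h \<otimes> k) - \<tau> h - \<tau> k"
      using h k by (intro tendsto_diff lim) auto
    ultimately have "\<tau> (h \<otimes> k) - \<tau> h - \<tau> k = 0"
      using LIMSEQ_unique by blast
    then show ?thesis by simp
  qed
  moreover have "\<tau> h \<le> \<tau> k" if "h \<in> carrier G" "k \<in> carrier G" "h \<preceq> k" for h k
  proof -
    have "approx h n \<le> approx k n" for n
      using that level_mono[OF _ _ le_pow[OF that]] by (simp add: approx_def divide_right_mono)
    then show ?thesis
      using LIMSEQ_le[OF lim lim] that by blast
  qed
  ultimately show ?thesis by blast
qed

end

section \<open>Groups of homeomorphisms of the line\<close>

lemma closed_Fix: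
  fixes f :: "real \<Rightarrow> real"
  assumes "continuous_on UNIV f"
  shows "closed (Fix f)"
  using closed_Collect_eq[OF assms continuous_on_id] by (simp add: Fix_def id_def)

text \<open>Compactness of \<open>S \<inter> {x..p}\<close> gives the minimum. With \<open>S\<close>
  a fixed point set, this finds the upper end of a component of its complement.\<close>

lemma next_element_above:
  fixes S :: "real set"
  assumes "closed S" "p \<in> S" "x \<le> p"
  obtains b where "b \<in> S" "x \<le> b" "b \<le> p" "\<And>y. x \<le> y \<Longrightarrow> y < b \<Longrightarrow> y \<notin> S"
proof -
  have "compact (S \<inter> {x..p})" "S \<inter> {x..p} \<noteq> {}"
    using assms by (auto intro: closed_Int_compact)
  then obtain b where "b \<in> S \<inter> {x..p}" "\<And>t. t \<in> S \<inter> {x..p} \<Longrightarrow> b \<le> t"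
    using compact_attains_inf by metis
  then show ?thesis using that[of b] by force
qed

lemma next_element_below:
  fixes S :: "real set"
  assumes "closed S" "p \<in> S" "p \<le> x"
  obtains a where "a \<in> S" "p \<le> a" "a \<le> x" "\<And>y. a < y \<Longrightarrow> y \<le> x \<Longrightarrow> y \<notin> S"
proof -
  have "compact (S \<inter> {p..x})" "S \<inter> {p..x} \<noteq> {}"
    using assms by (auto intro: closed_Int_compact)
  then obtain a where "a \<in> S \<inter> {p..x}" "\<And>t. t \<in> S \<inter> {p..x} \<Longrightarrow> t \<le> a"
    using compact_attains_sup by metis
  then show ?thesis using that[of a] by force
qed

lemma extend_ereal_simps [simp]:
  "extend_ereal f (ereal x) = ereal (f x)" "extend_ereal f \<infinity> = \<infinity>" "extend_ereal f (-\<infinity>) = -\<infinity>"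
  by (simp_all add: extend_ereal_def flip: infinity_ereal_def)

text \<open>The component of the complement of \<open>Fix f\<close> that starts at \<open>a\<close>
  contains \<open>g a\<close>. Its upper end is the next fixed point beyond \<open>g a\<close>, or
  \<open>\<infinity>\<close> if there is none; the two cases produce the crossing interval.\<close>

lemma crossed_above:
  assumes cont: "continuous_on UNIV f" and a: "f a = a" "a < g a"
    and nofix: "\<And>y. a < y \<Longrightarrow> y \<le> g a \<Longrightarrow> f y \<noteq> y"
  shows "crossed f g"
proof (cases "\<exists>p \<ge> g a. f p = p")
  case True
  then obtain p where "p \<in> Fix f" "g a \<le> p" by (auto simp: Fix_def)
  then obtain b where b: "b \<in> Fix f" "g a \<le> b" "\<And>y. g a \<le> y \<Longrightarrow> y < b \<Longrightarrow> y \<notin> Fix f"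
    using next_element_above[OF closed_Fix[OF cont]] by metis
  have "g a < b"
    using nofix[of b] a b(1,2) by (cases "g a = b") (auto simp: Fix_def)
  have uniq: "y = a \<or> y = b" if "f y = y" "a \<le> y" "y \<le> b" for y
    using that nofix[of y] b(3)[of y] by (force simp: Fix_def)
  have "Fix (extend_ereal f) \<inter> {ereal a..ereal b} = {ereal a, ereal b}"
  proof (rule Set.set_eqI)
    fix y
    show "y \<in> Fix (extend_ereal f) \<inter> {ereal a..ereal b} \<longleftrightarrow> y \<in> {ereal a, ereal b}"
      using a b uniq \<open>g a < b\<close> by (cases y) (auto simp: Fix_def)
  qed
  then have "crosses f g (ereal a) (ereal b)"
    using a(2) \<open>g a < b\<close> by (simp add: crosses_def)
  moreover have "ereal a < ereal b" using a(2) \<open>g a < b\<close> by simp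
  ultimately show ?thesis unfolding crossed_def by blast
next
  case False
  have uniq: "y = a" if "f y = y" "a \<le> y" for y
    using that nofix[of y] False by force
  have "Fix (extend_ereal f) \<inter> {ereal a..\<infinity>} = {ereal a, \<infinity>}"
  proof (rule Set.set_eqI)
    fix y
    show "y \<in> Fix (extend_ereal f) \<inter> {ereal a..\<infinity>} \<longleftrightarrow> y \<in> {ereal a, \<infinity>}"
      using a uniq by (cases y) (auto simp: Fix_def)
  qed
  then have "crosses f g (ereal a) \<infinity>"
    using a(2) by (simp add: crosses_def)
  moreover have "ereal a < \<infinity>" by simp
  ultimately show ?thesis unfolding crossed_def by blast
qed

text \<open>Mirror image of \<open>crossed_above\<close>, with \<open>-\<infinity>\<close> as the
  possible lower end.\<close>

lemma crossed_below:
  assumes cont: "continuous_on UNIV f" and b: "f b = b" "g b < b"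
    and nofix: "\<And>y. g b \<le> y \<Longrightarrow> y < b \<Longrightarrow> f y \<noteq> y"
  shows "crossed f g"
proof (cases "\<exists>p \<le> g b. f p = p")
  case True
  then obtain p where "p \<in> Fix f" "p \<le> g b" by (auto simp: Fix_def)
  then obtain a where a: "a \<in> Fix f" "a \<le> g b" "\<And>y. a < y \<Longrightarrow> y \<le> g b \<Longrightarrow> y \<notin> Fix f"
    using next_element_below[OF closed_Fix[OF cont]] by metis
  have "a < g b"
    using nofix[of a] b a(1,2) by (cases "g b = a") (auto simp: Fix_def)
  have uniq: "y = a \<or> y = b" if "f y = y" "a \<le> y" "y \<le> b" for y
    using that nofix[of y] a(3)[of y] by (force simp: Fix_def)
  have "Fix (extend_ereal f) \<inter> {ereal a..ereal b} = {ereal a, ereal b}"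
  proof (rule Set.set_eqI)
    fix y
    show "y \<in> Fix (extend_ereal f) \<inter> {ereal a..ereal b} \<longleftrightarrow> y \<in> {ereal a, ereal b}"
      using a b uniq \<open>a < g b\<close> by (cases y) (auto simp: Fix_def)
  qed
  then have "crosses f g (ereal a) (ereal b)"
    using b(2) \<open>a < g b\<close> by (simp add: crosses_def)
  moreover have "ereal a < ereal b" using b(2) \<open>a < g b\<close> by simp
  ultimately show ?thesis unfolding crossed_def by blast
next
  case False
  have uniq: "y = b" if "f y = y" "y \<le> b" for y
    using that nofix[of y] False by force
  have "Fix (extend_ereal f) \<inter> {-\<infinity>..ereal b} = {-\<infinity>, ereal b}"
  proof (rule Set.set_eqI)
    fix y
    show "y \<in> Fix (extend_ereal f) \<inter> {-\<infinity>..ereal b} \<longleftrightarrow> y \<in> {-\<infinity>, ereal b}"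
      using b uniq by (cases y) (auto simp: Fix_def)
  qed
  then have "crosses f g (-\<infinity>) (ereal b)"
    using b(2) by (simp add: crosses_def)
  moreover have "- \<infinity> < ereal b" by simp
  ultimately show ?thesis unfolding crossed_def by blast
qed

section \<open>Orbits, minimal sets and iteration\<close>

locale line_group =
  fixes G :: "(real \<Rightarrow> real) set"
  assumes subgroup: "subgroup G homeo_plus"
begin

lemma id_mem: "id \<in> G"
  using subgroup.one_closed[OF subgroup] by (simp add: homeo_plus_def)

lemma comp_mem: "f \<in> G \<Longrightarrow> g \<in> G \<Longrightarrow> f \<circ> g \<in> G"
  using subgroup.m_closed[OF subgroup] by (simp add: homeo_plus_def)

lemma homeoE:
  assumes "f \<in> G"
  obtains g where "strict_mono f" "homeomorphism UNIV UNIV f g"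
  using subgroup.mem_carrier[OF subgroup assms] by (auto simp: homeo_plus_def)

lemma less_iff: "f \<in> G \<Longrightarrow> f x < f y \<longleftrightarrow> x < y"
  and le_iff: "f \<in> G \<Longrightarrow> f x \<le> f y \<longleftrightarrow> x \<le> y"
  by (metis homeoE strict_mono_less strict_mono_less_eq)+

lemma cont: "f \<in> G \<Longrightarrow> continuous_on S f"
  by (metis homeoE homeomorphism_def continuous_on_subset subset_UNIV)

lemma inverseE:
  assumes "f \<in> G"
  obtains g where "g \<in> G" "\<And>x. f (g x) = x" "\<And>x. g (f x) = x"
proof -
  have "inv\<^bsub>homeo_plus\<^esub> f \<in> G"
    using subgroup.m_inv_closed[OF subgroup assms] .
  moreover have "f \<circ> inv\<^bsub>homeo_plus\<^esub> f = id" "inv\<^bsub>homeo_plus\<^esub> f \<circ> f = id"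
    using group.r_inv[OF group_homeo_plus subgroup.mem_carrier[OF subgroup assms]]
      group.l_inv[OF group_homeo_plus subgroup.mem_carrier[OF subgroup assms]]
    by (auto simp: homeo_plus_def)
  ultimately show ?thesis
    using that by (metis comp_apply id_apply)
qed

lemma funpow_mem: "f \<in> G \<Longrightarrow> f ^^ n \<in> G"
  by (induction n) (auto intro: id_mem[unfolded id_def] comp_mem simp: id_mem)

text \<open>The inclusion for the inverse of \<open>f\<close> is the opposite inclusion for
  \<open>f\<close>.\<close>

lemma invariant_setI:
  assumes "\<And>f. f \<in> G \<Longrightarrow> f ` A \<subseteq> A"
  shows "invariant_set G A"
  unfolding invariant_set_def
proof
  fix f assume f: "f \<in> G"
  obtain g where "g \<in> G" "\<And>x. f (g x) = x" using inverseE[OF f] by metis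
  then have "A \<subseteq> f ` A"
    using assms[of g] by (metis image_eqI image_subset_iff subsetI)
  with assms[OF f] show "f ` A = A" by blast
qed

lemma closure_orbit_invariant: "invariant_set G (closure ((\<lambda>f. f x) ` G))"
proof (rule invariant_setI)
  fix f assume f: "f \<in> G"
  have "f ` closure ((\<lambda>f. f x) ` G) \<subseteq> closure (f ` (\<lambda>f. f x) ` G)"
    using cont[OF f] by (intro image_closure_subset closure_subset) auto
  also have "f ` (\<lambda>f. f x) ` G \<subseteq> (\<lambda>f. f x) ` G"
  proof clarify
    fix k assume "k \<in> G"
    then show "f (k x) \<in> (\<lambda>f. f x) ` G"
      using comp_mem[OF f] by (intro image_eqI[of _ _ "f \<circ> k"]) auto
  qed
  finally show "f ` closure ((\<lambda>f. f x) ` G) \<subseteq> closure ((\<lambda>f. f x) ` G)"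
    by (meson closure_mono order.trans)
qed

text \<open>The closure of the orbit is a nonempty closed invariant subset of \<open>A\<close>, so
  minimality forces equality.\<close>

lemma minimal_orbit_dense:
  assumes "minimal_closed_set G A" "x \<in> A"
  shows "closure ((\<lambda>f. f x) ` G) = A"
proof -
  have A: "closed A" "\<And>g. g \<in> G \<Longrightarrow> g ` A = A"
    "\<And>B. B \<noteq> {} \<Longrightarrow> closed B \<Longrightarrow> invariant_set G B \<Longrightarrow> B \<subseteq> A \<Longrightarrow> B = A"
    using assms(1) by (auto simp: minimal_closed_set_def invariant_set_def)
  have "(\<lambda>f. f x) ` G \<subseteq> A"
    using A(2) assms(2) by blast
  moreover have "closure ((\<lambda>f. f x) ` G) \<noteq> {}"
    using id_mem by auto
  ultimately show ?thesis
    using A closure_orbit_invariant by (simp add: closure_minimal)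
qed

lemma ex_minimal_closed_set:
  assumes K: "compact K" and meets: "\<And>x. \<exists>f\<in>G. f x \<in> K"
  shows "\<exists>A. minimal_closed_set G A"
proof -
  \<comment> \<open>Zorn's lemma is applied to complements: a maximal open set here has a minimal
    complement. A nonempty invariant set meets \<open>K\<close>, so nonemptiness of the complement
    becomes \<open>\<not> K \<subseteq> U\<close>, a condition that compactness carries over to
    unions of chains.\<close>
  define \<U> where "\<U> = {U. open U \<and> invariant_set G (- U) \<and> \<not> K \<subseteq> U}"
  have "\<exists>M\<in>\<U>. \<forall>X\<in>\<U>. M \<subseteq> X \<longrightarrow> X = M"
  proof (rule subset_Zorn_nonempty)
    have "K \<noteq> {}" using meets by blast
    moreover have "invariant_set G UNIV" by (rule invariant_setI) simp
    ultimately have "{} \<in> \<U>" by (simp add: \<U>_def)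
    then show "\<U> \<noteq> {}" by blast
  next
    fix \<C> assume "\<C> \<noteq> {}" and chain: "subset.chain \<U> \<C>"
    then have sub: "\<C> \<subseteq> \<U>" by (simp add: subset.chain_def)
    have "invariant_set G (- \<Union>\<C>)"
    proof (rule invariant_setI)
      fix f assume f: "f \<in> G"
      have "f ` (- U) = - U" if "U \<in> \<C>" for U
        using that sub f by (auto simp: \<U>_def invariant_set_def)
      then show "f ` (- \<Union>\<C>) \<subseteq> - \<Union>\<C>" by blast
    qed
    moreover have "\<not> K \<subseteq> \<Union>\<C>"
    proof
      assume "K \<subseteq> \<Union>\<C>"
      moreover have "\<forall>U\<in>\<C>. open U" using sub by (auto simp: \<U>_def)
      ultimately obtain \<D> where \<D>: "\<D> \<subseteq> \<C>" "finite \<D>" "K \<subseteq> \<Union>\<D>"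
        using compactE[OF K] by metis
      have "\<D> \<noteq> {}" using \<D>(3) meets by fastforce
      moreover have "subset.chain \<U> \<D>"
        using chain \<D>(1) unfolding subset.chain_def by blast
      ultimately have "\<Union>\<D> \<in> \<D>"
        \<comment> \<open>A finite subcover taken from a chain is covered by its largest member,
          which would then contain \<open>K\<close>.\<close>
        using \<D>(2) Union_in_chain by blast
      then show False
        using \<D> sub by (auto simp: \<U>_def)
    qed
    ultimately show "\<Union>\<C> \<in> \<U>"
      using sub by (auto simp: \<U>_def)
  qed
  then obtain M where M: "open M" "invariant_set G (- M)" "\<not> K \<subseteq> M"
    and max: "\<And>U. open U \<Longrightarrow> invariant_set G (- U) \<Longrightarrow> \<not> K \<subseteq> U \<Longrightarrow> M \<subseteq> U \<Longrightarrow> U = M"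
    by (auto simp: \<U>_def)
  have "B = - M" if B: "B \<noteq> {}" "closed B" "invariant_set G B" "B \<subseteq> - M" for B
  proof -
    obtain x where "x \<in> B" using B by blast
    obtain f where "f \<in> G" "f x \<in> K" using meets by blast
    then have "f x \<in> B" using B(3) \<open>x \<in> B\<close> by (auto simp: invariant_set_def)
    then have "- B = M"
      using B \<open>f x \<in> K\<close> by (intro max) auto
    then show ?thesis by blast
  qed
  then have "minimal_closed_set G (- M)"
    using M by (auto simp: minimal_closed_set_def)
  then show ?thesis by blast
qed

text \<open>The inverse of \<open>g\<close> sends orbit points to orbit points, so the supremum is
  at most its image under \<open>g\<close>. Applying this to the inverse as well gives equality.
  Hence without a global fixed point every orbit is unbounded above.\<close>

lemma Sup_orbit_fixed:
  assumes bdd: "bdd_above ((\<lambda>f. f x) ` G)" and g: "g \<in> G"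
  shows "g (Sup ((\<lambda>f. f x) ` G)) = Sup ((\<lambda>f. f x) ` G)"
proof -
  let ?s = "Sup ((\<lambda>f. f x) ` G)"
  have le: "?s \<le> g ?s" if g: "g \<in> G" for g
  proof (rule cSUP_least)
    show "G \<noteq> {}" using id_mem by blast
    fix f assume f: "f \<in> G"
    obtain h where h: "h \<in> G" "\<And>x. g (h x) = x" using inverseE[OF g] by metis
    have "(h \<circ> f) x \<le> ?s"
      using cSUP_upper[OF comp_mem[OF h(1) f] bdd] .
    then have "g (h (f x)) \<le> g ?s" using le_iff[OF g] by simp
    then show "f x \<le> g ?s" by (simp add: h)
  qed
  obtain h where h: "h \<in> G" "\<And>x. g (h x) = x" using inverseE[OF g] by metis
  have "g ?s \<le> g (h ?s)" using le[OF h(1)] le_iff[OF g] by simp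
  then show ?thesis using le[OF g] h by simp
qed

lemma Inf_orbit_fixed:
  assumes bdd: "bdd_below ((\<lambda>f. f x) ` G)" and g: "g \<in> G"
  shows "g (Inf ((\<lambda>f. f x) ` G)) = Inf ((\<lambda>f. f x) ` G)"
proof -
  let ?s = "Inf ((\<lambda>f. f x) ` G)"
  have le: "g ?s \<le> ?s" if g: "g \<in> G" for g
  proof (rule cINF_greatest)
    show "G \<noteq> {}" using id_mem by blast
    fix f assume f: "f \<in> G"
    obtain h where h: "h \<in> G" "\<And>x. g (h x) = x" using inverseE[OF g] by metis
    have "?s \<le> (h \<circ> f) x"
      using cINF_lower[OF bdd comp_mem[OF h(1) f]] .
    then have "g ?s \<le> g (h (f x))" using le_iff[OF g] by simp
    then show "g ?s \<le> f x" by (simp add: h)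
  qed
  obtain h where h: "h \<in> G" "\<And>x. g (h x) = x" using inverseE[OF g] by metis
  have "g (h ?s) \<le> g ?s" using le[OF h(1)] le_iff[OF g] by simp
  then show ?thesis using le[OF g] h by simp
qed

lemma no_sign_change:
  assumes f: "f \<in> G" and nofix: "\<And>y. x \<le> y \<Longrightarrow> y \<le> z \<Longrightarrow> f y \<noteq> y" and "x \<le> z"
  shows "x < f x \<longleftrightarrow> z < f z"
proof -
  have c: "continuous_on {x..z} (\<lambda>y. f y - y)"
    using cont[OF f] by (intro continuous_intros)
  have ne: "f x \<noteq> x" "f z \<noteq> z" using nofix \<open>x \<le> z\<close> by auto
  show ?thesis
  proof (rule ccontr)
    assume "\<not> ?thesis"
    then have "(f x - x \<le> 0 \<and> 0 \<le> f z - z) \<or> (f z - z \<le> 0 \<and> 0 \<le> f x - x)"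
      using ne by auto
    then obtain y where "x \<le> y" "y \<le> z" "f y - y = 0"
      using IVT'[OF _ _ \<open>x \<le> z\<close> c, of 0] IVT2'[OF _ _ \<open>x \<le> z\<close> c, of 0] by blast
    then show False using nofix by simp
  qed
qed

lemma limit_fixed:
  assumes f: "f \<in> G" and lim: "(\<lambda>n. (f ^^ n) x) \<longlonglongrightarrow> l"
  shows "f l = l"
proof -
  have "isCont f l" using cont[OF f, of UNIV] by (simp add: continuous_on_eq_continuous_at)
  then have "(\<lambda>n. f ((f ^^ n) x)) \<longlonglongrightarrow> f l"
    using lim isCont_tendsto_compose by blast
  moreover have "(\<lambda>n. f ((f ^^ n) x)) \<longlonglongrightarrow> l"
    using LIMSEQ_Suc[OF lim] by simp
  ultimately show ?thesis using LIMSEQ_unique by blast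
qed

lemma funpow_incseq:
  assumes f: "f \<in> G" and "x \<le> f x"
  shows "incseq (\<lambda>n. (f ^^ n) x)"
proof (rule incseq_SucI)
  show "(f ^^ n) x \<le> (f ^^ Suc n) x" for n
    using le_iff[OF funpow_mem[OF f], of n x "f x"] assms by (simp add: funpow_swap1)
qed

lemma funpow_decseq:
  assumes f: "f \<in> G" and "f x \<le> x"
  shows "decseq (\<lambda>n. (f ^^ n) x)"
proof (rule decseq_SucI)
  show "(f ^^ Suc n) x \<le> (f ^^ n) x" for n
    using le_iff[OF funpow_mem[OF f], of n "f x" x] assms by (simp add: funpow_swap1)
qed

text \<open>If the iterates stayed below \<open>z\<close>, they would increase to a limit in
  \<open>[x, z]\<close>, which would be a fixed point.\<close>

lemma funpow_exceeds:
  assumes f: "f \<in> G" and "x \<le> f x" and nofix: "\<And>y. x \<le> y \<Longrightarrow> y \<le> z \<Longrightarrow> f y \<noteq> y"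
  obtains n where "z < (f ^^ n) x"
proof (rule ccontr)
  assume "\<not> thesis"
  then have b: "(f ^^ n) x \<le> z" for n using that not_le by blast
  then obtain l where l: "(\<lambda>n. (f ^^ n) x) \<longlonglongrightarrow> l"
    using incseq_convergent[OF funpow_incseq[OF f \<open>x \<le> f x\<close>]] by blast
  have "l \<le> z" using l b LIMSEQ_le_const2 by blast
  moreover have "x \<le> l"
    using incseq_le[OF funpow_incseq[OF f \<open>x \<le> f x\<close>] l, of 0] by simp
  ultimately show False using nofix limit_fixed[OF f l] by blast
qed

lemma funpow_falls_below:
  assumes f: "f \<in> G" and "f x \<le> x" and nofix: "\<And>y. z \<le> y \<Longrightarrow> y \<le> x \<Longrightarrow> f y \<noteq> y"
  obtains n where "(f ^^ n) x < z"
proof (rule ccontr)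
  assume "\<not> thesis"
  then have b: "z \<le> (f ^^ n) x" for n using that not_le by blast
  then obtain l where l: "(\<lambda>n. (f ^^ n) x) \<longlonglongrightarrow> l"
    using decseq_convergent[OF funpow_decseq[OF f \<open>f x \<le> x\<close>]] by blast
  have "z \<le> l" using l b LIMSEQ_le_const by blast
  moreover have "l \<le> x"
    using decseq_ge[OF funpow_decseq[OF f \<open>f x \<le> x\<close>] l, of 0] by simp
  ultimately show False using nofix limit_fixed[OF f l] by blast
qed

lemma image_Ioc:
  assumes f: "f \<in> G"
  shows "f ` {a<..b} = {f a<..f b}"
proof -
  obtain g where g: "\<And>x. f (g x) = x" using inverseE[OF f] by metis
  show ?thesis
  proof
    show "f ` {a<..b} \<subseteq> {f a<..f b}"
      using less_iff[OF f] le_iff[OF f] by auto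
    show "{f a<..f b} \<subseteq> f ` {a<..b}"
    proof
      fix y assume "y \<in> {f a<..f b}"
      then have "g y \<in> {a<..b}"
        using less_iff[OF f, of a "g y"] le_iff[OF f, of "g y" b] g by simp
      then show "y \<in> f ` {a<..b}" using g by (metis image_eqI)
    qed
  qed
qed

lemma next_fixed_above:
  assumes "f \<in> G" "f p = p" "x \<le> p"
  obtains b where "f b = b" "x \<le> b" "b \<le> p" "\<And>y. x \<le> y \<Longrightarrow> y < b \<Longrightarrow> f y \<noteq> y"
  using next_element_above[OF closed_Fix[OF cont[OF assms(1)]], of p x] assms(2,3)
  unfolding Fix_def mem_Collect_eq by blast

lemma next_fixed_below:
  assumes "f \<in> G" "f p = p" "p \<le> x"
  obtains a where "f a = a" "p \<le> a" "a \<le> x" "\<And>y. a < y \<Longrightarrow> y \<le> x \<Longrightarrow> f y \<noteq> y"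
  using next_element_below[OF closed_Fix[OF cont[OF assms(1)]], of p x] assms(2,3)
  unfolding Fix_def mem_Collect_eq by blast

lemma unfixed_nhd:
  assumes f: "f \<in> G" and x: "f x \<noteq> x"
  obtains d where "d > 0" "\<And>y. \<bar>x - y\<bar> < d \<Longrightarrow> f y \<noteq> y"
proof -
  have "open (- Fix f)" "x \<in> - Fix f"
    using closed_Fix[OF cont[OF f]] x by (auto simp: open_Compl Fix_def)
  then obtain d where "d > 0" "ball x d \<subseteq> - Fix f"
    using open_contains_ball by blast
  then show ?thesis
    using that[of d] by (auto simp: Fix_def dist_real_def subset_iff)
qed

section \<open>Invariant measures and towers\<close>

lemma null_to_fixed_point:
  assumes \<mu>: "radon_measure \<mu>" "invariant_measure G \<mu>"
    and f: "f \<in> G" "f a = a" and nofix: "\<And>y. a < y \<Longrightarrow> y \<le> c \<Longrightarrow> f y \<noteq> y"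
  shows "emeasure \<mu> {a<..c} = 0"
proof (cases "a < c")
  case True
  have sets: "sets \<mu> = sets borel" using \<mu> by (simp add: radon_measure_def)
  obtain f' where f': "f' \<in> G" "\<And>x. f (f' x) = x" "\<And>x. f' (f x) = x"
    using inverseE[OF f(1)] by metis
  \<comment> \<open>\<open>h\<close> is \<open>f\<close> or its inverse, whichever does not move
    \<open>c\<close> up; its iterates then push \<open>c\<close> down to \<open>a\<close>.\<close>
  obtain h where h: "h \<in> G" "h a = a" "h c \<le> c" "\<And>y. a < y \<Longrightarrow> y \<le> c \<Longrightarrow> h y \<noteq> y"
  proof (cases "f c \<le> c")
    case True
    then show ?thesis using that f nofix by blast
  next
    case False
    moreover have "f' c \<le> c" using le_iff[OF f(1), of "f' c" c] False f' by simp
    moreover have "f' y \<noteq> y" if "a < y" "y \<le> c" for y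
      using nofix that f'(2)[of y] by auto
    ultimately show ?thesis using that[of f'] f f' by metis
  qed
  define c' where "c' n = (h ^^ n) c" for n
  have dec: "decseq c'" using funpow_decseq[OF h(1,3)] by (simp add: c'_def[abs_def])
  have const: "emeasure \<mu> {a<..c' n} = emeasure \<mu> {a<..c}" for n
  proof (induction n)
    case (Suc n)
    have "emeasure \<mu> (h ` {a<..c' n}) = emeasure \<mu> {a<..c' n}"
      using \<mu>(2) h(1) by (simp add: invariant_measure_def)
    then show ?case using Suc by (simp add: image_Ioc[OF h(1)] h(2) c'_def)
  qed (simp add: c'_def)
  \<comment> \<open>Continuity from above needs finite measure, which comes from the compact
    interval \<open>[a, c]\<close>.\<close>
  have "emeasure \<mu> {a<..c} \<le> emeasure \<mu> {a..c}"
    using sets by (intro emeasure_mono) auto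
  also have "\<dots> < \<infinity>" using \<mu>(1) by (simp add: radon_measure_def)
  finally have fin: "emeasure \<mu> {a<..c} < \<infinity>" .
  have "(\<Inter>n. {a<..c' n}) = {}"
  proof -
    have "\<exists>n. c' n < x" if x: "a < x" for x
    proof (cases "x \<le> c")
      case True
      obtain n where "(h ^^ n) c < x"
        using funpow_falls_below[OF h(1,3), of x] h(4) x by (metis order.strict_trans2)
      then show ?thesis by (auto simp: c'_def)
    next
      case False
      then show ?thesis by (intro exI[of _ 0]) (simp add: c'_def)
    qed
    then show ?thesis by (auto simp: not_le) (meson not_le)
  qed
  moreover have "(\<lambda>n. emeasure \<mu> {a<..c' n}) \<longlonglongrightarrow> emeasure \<mu> (\<Inter>n. {a<..c' n})"
  proof (rule Lim_emeasure_decseq)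
    show "decseq (\<lambda>n. {a<..c' n})"
      by (auto simp: decseq_def intro: order.trans[OF _ decseqD[OF dec]])
  qed (use sets fin const in auto)
  ultimately show ?thesis
    by (simp add: const LIMSEQ_const_iff)
qed simp

lemma tower_null:
  assumes \<mu>: "radon_measure \<mu>" "invariant_measure G \<mu>"
    and tower: "infinite_tower a b f" "\<And>i. f i \<in> G" and un: "(\<Union>i. {a i..b i}) = UNIV"
  shows "emeasure \<mu> UNIV = 0"
proof -
  have sets: "sets \<mu> = sets borel" using \<mu> by (simp add: radon_measure_def)
  have T: "{a i..b i} \<subseteq> {a (Suc i)..b (Suc i)}" "Fix (f i) \<inter> {a i..b i} = {a i, b i}" "a i < b i" for i
    using tower(1) unfolding infinite_tower_def by blast+
  have mono: "{a i..b i} \<subseteq> {a j..b j}" if "i \<le> j" for i j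
    using lift_Suc_mono_le[of "\<lambda>i. {a i..b i}", OF T(1) that] .
  have "emeasure \<mu> {- real n..real n} = 0" for n
  proof -
    \<comment> \<open>The margin of one places \<open>[-n, n]\<close> strictly inside
      \<open>(a k, b k)\<close>, so that no fixed point of \<open>f k\<close> lies in
      \<open>(a k, n]\<close>.\<close>
    have "- real n - 1 \<in> (\<Union>i. {a i..b i})" "real n + 1 \<in> (\<Union>i. {a i..b i})"
      by (simp_all only: un UNIV_I)
    then obtain i j where "- real n - 1 \<in> {a i..b i}" "real n + 1 \<in> {a j..b j}"
      by blast
    then have "- real n - 1 \<in> {a (max i j)..b (max i j)}" "real n + 1 \<in> {a (max i j)..b (max i j)}"
      using mono[of i "max i j"] mono[of j "max i j"] by auto
    then obtain k where k: "a k \<le> - real n - 1" "real n + 1 \<le> b k" by auto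
    have fixk: "y = a k \<or> y = b k" if "f k y = y" "a k \<le> y" "y \<le> b k" for y
    proof -
      have "y \<in> Fix (f k) \<inter> {a k..b k}" using that by (simp add: Fix_def)
      then show ?thesis unfolding T(2) by simp
    qed
    have "a k \<in> Fix (f k) \<inter> {a k..b k}" unfolding T(2) by simp
    then have "f k (a k) = a k" by (simp add: Fix_def)
    moreover have "f k y \<noteq> y" if "a k < y" "y \<le> real n" for y
      using fixk[of y] that k by auto
    ultimately have "emeasure \<mu> {a k<..real n} = 0"
      by (rule null_to_fixed_point[OF \<mu> tower(2)])
    moreover have "emeasure \<mu> {- real n..real n} \<le> emeasure \<mu> {a k<..real n}"
      using sets k by (intro emeasure_mono) auto
    ultimately show ?thesis by simp
  qed
  then have "(\<Union>n. {- real n..real n}) \<in> null_sets \<mu>"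
    using sets by (intro null_sets_UN) auto
  moreover have "(\<Union>n. {- real n..real n}) = UNIV"
  proof -
    have "\<exists>n. - real n \<le> x \<and> x \<le> real n" for x
      using real_arch_simple[of "\<bar>x\<bar>"] by (metis abs_le_iff minus_le_iff)
    then show ?thesis by auto
  qed
  ultimately show ?thesis by auto
qed

section \<open>Minimal sets or towers\<close>

text \<open>Either \<open>f\<close> or its inverse, called \<open>h\<close>, moves every point from
  \<open>c\<close> on down. Without a global fixed point each orbit passes beyond \<open>c\<close>;
  iterating \<open>h\<close> from there, the first iterate below \<open>c\<close> lies in
  \<open>[h c, c]\<close>. This compact interval therefore meets every orbit.\<close>

lemma minimal_if_eventually_unfixed_above:
  assumes f: "f \<in> G" and nofix: "\<And>y. c \<le> y \<Longrightarrow> f y \<noteq> y"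
    and noglobal: "\<And>x. \<exists>g\<in>G. g x \<noteq> x"
  shows "\<exists>A. minimal_closed_set G A"
proof -
  obtain h where h: "h \<in> G" "\<And>y. c \<le> y \<Longrightarrow> h y < y"
  proof -
    obtain f' where f': "f' \<in> G" "\<And>x. f (f' x) = x" "\<And>x. f' (f x) = x"
      using inverseE[OF f(1)] by metis
    have same: "c < f c \<longleftrightarrow> y < f y" if "c \<le> y" for y
      using no_sign_change[OF f _ that] nofix by simp
    show ?thesis
    proof (cases "c < f c")
      case True
      then have "f' y < y" if "c \<le> y" for y
        using less_iff[OF f, of "f' y" y] same that f' by simp
      then show ?thesis using that f' by blast
    next
      case False
      then have "f y < y" if "c \<le> y" for y
        using same[OF that] nofix[OF that] by simp
      then show ?thesis using that f by blast
    qed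
  qed
  show ?thesis
  proof (rule ex_minimal_closed_set[of "{h c..c}"])
    fix x
    have "\<not> bdd_above ((\<lambda>f. f x) ` G)"
      using Sup_orbit_fixed noglobal by blast
    then obtain k where k: "k \<in> G" "c < k x"
      by (force simp: bdd_above_def not_le)
    have "h y \<noteq> y" if "c \<le> y" for y using h(2)[OF that] by simp
    then obtain n where "(h ^^ n) (k x) < c"
      using funpow_falls_below[OF h(1), of "k x" c] h(2)[of "k x"] k by auto
    then obtain m where m: "(h ^^ m) (k x) < c" "\<And>i. i < m \<Longrightarrow> c \<le> (h ^^ i) (k x)"
      using exists_least_iff[of "\<lambda>n. (h ^^ n) (k x) < c"] by (auto simp: not_less)
    \<comment> \<open>\<open>m\<close> is not 0 because \<open>k x\<close> lies above
      \<open>c\<close>; so the preceding iterate is at least \<open>c\<close>, and its image is at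
      least \<open>h c\<close>.\<close>
    then obtain p where p: "m = Suc p" using k by (cases m) auto
    then have "h c \<le> (h ^^ m) (k x)"
      using m(2)[of p] le_iff[OF h(1)] by simp
    then have "((h ^^ m) \<circ> k) x \<in> {h c..c}" using m by simp
    then show "\<exists>f\<in>G. f x \<in> {h c..c}"
      using comp_mem[OF funpow_mem[OF h(1)] k(1)] by blast
  qed simp
qed

text \<open>Mirror image of \<open>minimal_if_eventually_unfixed_above\<close>, with
  \<open>h\<close> moving points up.\<close>

lemma minimal_if_eventually_unfixed_below:
  assumes f: "f \<in> G" and nofix: "\<And>y. y \<le> c \<Longrightarrow> f y \<noteq> y"
    and noglobal: "\<And>x. \<exists>g\<in>G. g x \<noteq> x"
  shows "\<exists>A. minimal_closed_set G A"
proof -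
  obtain h where h: "h \<in> G" "\<And>y. y \<le> c \<Longrightarrow> y < h y"
  proof -
    obtain f' where f': "f' \<in> G" "\<And>x. f (f' x) = x" "\<And>x. f' (f x) = x"
      using inverseE[OF f(1)] by metis
    have same: "c < f c \<longleftrightarrow> y < f y" if "y \<le> c" for y
      using no_sign_change[OF f _ that] nofix by simp
    show ?thesis
    proof (cases "c < f c")
      case True
      then have "y < f y" if "y \<le> c" for y
        using same[OF that] by simp
      then show ?thesis using that f by blast
    next
      case False
      then have "y < f' y" if "y \<le> c" for y
        using less_iff[OF f, of y "f' y"] same[OF that] nofix[OF that] that f' by simp
      then show ?thesis using that f' by blast
    qed
  qed
  show ?thesis
  proof (rule ex_minimal_closed_set[of "{c..h c}"])
    fix x
    have "\<not> bdd_below ((\<lambda>f. f x) ` G)"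
      using Inf_orbit_fixed noglobal by blast
    then obtain k where k: "k \<in> G" "k x < c"
      by (force simp: bdd_below_def not_le)
    have "h y \<noteq> y" if "y \<le> c" for y using h(2)[OF that] by simp
    then obtain n where "c < (h ^^ n) (k x)"
      using funpow_exceeds[OF h(1), of "k x" c] h(2)[of "k x"] k by auto
    then obtain m where m: "c < (h ^^ m) (k x)" "\<And>i. i < m \<Longrightarrow> (h ^^ i) (k x) \<le> c"
      using exists_least_iff[of "\<lambda>n. c < (h ^^ n) (k x)"] by (auto simp: not_less)
    then obtain p where p: "m = Suc p" using k by (cases m) auto
    then have "(h ^^ m) (k x) \<le> h c"
      using m(2)[of p] le_iff[OF h(1)] by simp
    then have "((h ^^ m) \<circ> k) x \<in> {c..h c}" using m by simp
    then show "\<exists>f\<in>G. f x \<in> {c..h c}"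
      using comp_mem[OF funpow_mem[OF h(1)] k(1)] by blast
  qed simp
qed

end

locale uncrossed_line_group = line_group +
  assumes uncrossed: "f \<in> G \<Longrightarrow> g \<in> G \<Longrightarrow> \<not> crossed f g"
begin

text \<open>Bolzano's bisection principle: the property holds on small intervals around each point
  by continuity, and passes to the union of two adjacent intervals because a failure would produce a
  crossing.\<close>

lemma ex_unfixed_interval:
  assumes noglobal: "\<And>x. \<exists>g\<in>G. g x \<noteq> x" and "x \<le> z"
  shows "\<exists>f\<in>G. \<forall>y\<in>{x..z}. f y \<noteq> y"
  using \<open>x \<le> z\<close>
proof (induction rule: Bolzano)
  case (trans x y z)
  then obtain f h where f: "f \<in> G" "\<forall>t\<in>{x..y}. f t \<noteq> t" and h: "h \<in> G" "\<forall>t\<in>{y..z}. h t \<noteq> t"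
    by blast
  show ?case
  proof (rule ccontr)
    assume no: "\<not> ?case"
    then have "\<exists>p\<in>{x..z}. f p = p" "\<exists>q\<in>{x..z}. h q = q"
      using f(1) h(1) by blast+
    then obtain p q where p: "f p = p" "x \<le> p" "p \<le> z" and q: "h q = q" "x \<le> q" "q \<le> z"
      by auto
    have "y < p" using f(2) p by (meson atLeastAtMost_iff not_le)
    have "q < y" using h(2) q by (meson atLeastAtMost_iff not_le)
    obtain b where b: "f b = b" "y \<le> b" "b \<le> p" "\<And>t. y \<le> t \<Longrightarrow> t < b \<Longrightarrow> f t \<noteq> t"
      using next_fixed_above[OF f(1) p(1), of y] \<open>y < p\<close> by (metis less_imp_le)
    have moved: "f t \<noteq> t" if "x \<le> t" "t < b" for t
      using b(4)[of t] f(2) that by (cases "y \<le> t") auto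
    obtain k where k: "k \<in> G" "k q = q" "k b < b"
    proof (cases "h b < b")
      case True
      then show ?thesis using that h q by blast
    next
      case False
      have "h b \<noteq> b" using h(2) b p by auto
      moreover obtain h' where h': "h' \<in> G" "\<And>x. h (h' x) = x" "\<And>x. h' (h x) = x"
        using inverseE[OF h(1)] by metis
      ultimately show ?thesis
        using that[of h'] False less_iff[OF h(1), of "h' b" b] q h' by (metis not_less_iff_gr_or_eq)
    qed
    have "q < k b" using less_iff[OF k(1), of q b] k(2) \<open>q < y\<close> b(2) by simp
    then have "crossed f k"
      using moved q(2) b(1) k(3) by (intro crossed_below[OF cont[OF f(1)], of b]) auto
    then show False using uncrossed f(1) k(1) by blast
  qed
next
  case (local x)
  obtain g where g: "g \<in> G" "g x \<noteq> x" using noglobal by blast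
  then obtain d where d: "d > 0" "\<And>y. \<bar>x - y\<bar> < d \<Longrightarrow> g y \<noteq> y"
    using unfixed_nhd by blast
  have "\<forall>y\<in>{a..b}. g y \<noteq> y" if "a \<le> x" "x \<le> b" "b - a < d" for a b
    using that by (intro ballI d(2)) auto
  then show ?case using d(1) g(1) by blast
qed

lemma ex_tower:
  assumes nomin: "\<nexists>A. minimal_closed_set G A"
  shows "\<exists>a b f. infinite_tower a b f \<and> (\<forall>i. f i \<in> G) \<and> (\<Union>i. {a i..b i}) = UNIV"
proof -
  have noglobal: "\<exists>g\<in>G. g x \<noteq> x" for x
  proof (rule ccontr)
    assume "\<not> ?thesis"
    then have "invariant_set G {x}" by (intro invariant_setI) auto
    then have "minimal_closed_set G {x}"
      by (auto simp: minimal_closed_set_def)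
    then show False using nomin by blast
  qed
  \<comment> \<open>If the fixed points of \<open>f\<close> stopped on either side, a minimal set
    would exist.\<close>
  have above: "\<exists>p\<ge>c. f p = p" and below: "\<exists>p\<le>c. f p = p" if "f \<in> G" for f c
    using minimal_if_eventually_unfixed_above[OF that _ noglobal]
      minimal_if_eventually_unfixed_below[OF that _ noglobal] nomin by blast+
  define P where "P t \<longleftrightarrow> (case t of (a, b, f) \<Rightarrow>
      a < b \<and> f \<in> G \<and> Fix f \<inter> {a..b} = {a, b})" for t :: "real \<times> real \<times> (real \<Rightarrow> real)"
  \<comment> \<open>The interval \<open>[x, z]\<close> is enlarged to the component of the
    complement of some \<open>Fix f\<close> around it; \<open>below\<close> and \<open>above\<close>
    make this component bounded.\<close>
  have ex: "\<exists>a b f. P (a, b, f) \<and> a < x \<and> z < b" if xz: "x \<le> z" for x z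
  proof -
    obtain f where f: "f \<in> G" "\<forall>y\<in>{x..z}. f y \<noteq> y"
      using ex_unfixed_interval[OF noglobal xz] by blast
    obtain p where p: "f p = p" "p \<le> x" using below[OF f(1), of x] by blast
    obtain a where a: "f a = a" "a \<le> x" "\<And>y. a < y \<Longrightarrow> y \<le> x \<Longrightarrow> f y \<noteq> y"
      using next_fixed_below[OF f(1) p] by metis
    obtain q where q: "f q = q" "z \<le> q" using above[OF f(1), of z] by blast
    obtain b where b: "f b = b" "z \<le> b" "\<And>y. z \<le> y \<Longrightarrow> y < b \<Longrightarrow> f y \<noteq> y"
      using next_fixed_above[OF f(1) q] by metis
    have "a \<noteq> x" "b \<noteq> z" using f(2) a(1) b(1) xz by (metis atLeastAtMost_iff order.refl)+
    have uniq: "y = a \<or> y = b" if "f y = y" "a \<le> y" "y \<le> b" for y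
    proof (rule ccontr)
      assume "\<not> ?thesis"
      then have "a < y" "y < b" using that by simp_all
      then have "x < y" "y < z" using a(3)[of y] b(3)[of y] that(1) by (meson not_le)+
      then show False using f(2) that(1) by simp
    qed
    have "Fix f \<inter> {a..b} = {a, b}"
    proof
      show "Fix f \<inter> {a..b} \<subseteq> {a, b}"
      proof
        fix y assume "y \<in> Fix f \<inter> {a..b}"
        then show "y \<in> {a, b}" using uniq[of y] by (simp add: Fix_def)
      qed
      show "{a, b} \<subseteq> Fix f \<inter> {a..b}"
        using a b xz by (simp add: Fix_def)
    qed
    then have "P (a, b, f)" "a < x" "z < b"
      using a(2) b(2) \<open>a \<noteq> x\<close> \<open>b \<noteq> z\<close> xz f(1) by (auto simp: P_def)
    then show ?thesis by blast
  qed
  \<comment> \<open>The terms \<open>fst t\<close> and \<open>fst (snd t)\<close> force strict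
    nesting; the terms \<open>- real n\<close> and \<open>real n\<close> force the intervals to
    exhaust the line.\<close>
  define Q where "Q n t t' \<longleftrightarrow> fst t' < min (fst t) (- real n) \<and> max (fst (snd t)) (real n) < fst (snd t')"
    for n and t t' :: "real \<times> real \<times> (real \<Rightarrow> real)"
  have "\<exists>s. \<forall>n. P (s n) \<and> Q n (s n) (s (Suc n))"
  proof (rule dependent_nat_choice)
    show "\<exists>t. P t" using ex[of 0 0] by blast
    fix t n
    show "\<exists>t'. P t' \<and> Q n t t'"
      using ex[of "min (fst t) (- real n)" "max (fst (snd t)) (real n)"] by (force simp: Q_def)
  qed
  then obtain s where s: "\<And>n. P (s n)" "\<And>n. Q n (s n) (s (Suc n))" by blast
  define a b f where "a n = fst (s n)" and "b n = fst (snd (s n))" and "f n = snd (snd (s n))" for n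
  have ab: "a n < b n" "f n \<in> G" "Fix (f n) \<inter> {a n..b n} = {a n, b n}" for n
    using s(1)[of n] by (auto simp: P_def a_def b_def f_def split: prod.splits)
  have step: "a (Suc n) < a n" "a (Suc n) < - real n" "b n < b (Suc n)" "real n < b (Suc n)" for n
    using s(2)[of n] by (auto simp: Q_def a_def b_def)
  have "{a n..b n} \<subset> {a (Suc n)..b (Suc n)}" for n
    using step(1,3)[of n] ab(1)[of n] by (auto simp: atLeastatMost_psubset_iff)
  then have "infinite_tower a b f"
    using ab subgroup.mem_carrier[OF subgroup] by (simp add: infinite_tower_def)
  moreover have "(\<Union>i. {a i..b i}) = UNIV"
  proof -
    have "\<exists>i. a i \<le> x \<and> x \<le> b i" for x
    proof -
      obtain n where "\<bar>x\<bar> \<le> real n" using real_arch_simple by blast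
      then have "a (Suc n) \<le> x \<and> x \<le> b (Suc n)" using step(2,4)[of n] by linarith
      then show ?thesis by blast
    qed
    then show ?thesis by auto
  qed
  ultimately show ?thesis using ab(2) by blast
qed

section \<open>The invariant measure of a minimal set\<close>

lemma fixes_minimal_set:
  assumes A: "minimal_closed_set G A" "x \<in> A" and g: "g \<in> G" "g p = p"
  shows "g x = x"
proof (rule ccontr)
  assume gx: "g x \<noteq> x"
  obtain g' where g': "g' \<in> G" "\<And>x. g (g' x) = x" "\<And>x. g' (g x) = x"
    using inverseE[OF g(1)] by metis
  have "closed A" and inv: "\<And>h y. h \<in> G \<Longrightarrow> y \<in> A \<Longrightarrow> h y \<in> A"
    using A(1) by (auto simp: minimal_closed_set_def invariant_set_def)
  obtain d where d: "d > 0" and near: "\<And>y. \<bar>x - y\<bar> < d \<Longrightarrow> g y \<noteq> y"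
    using unfixed_nhd[OF g(1) gx] by blast
  consider "p < x" | "x < p" using g gx by fastforce
  then show False
  proof cases
    case 1
    then obtain a where a: "g a = a" "a \<le> x" "\<And>y. a < y \<Longrightarrow> y \<le> x \<Longrightarrow> g y \<noteq> y"
      using next_fixed_below[OF g, of x] by (metis less_imp_le)
    then have "a < x" using gx by (cases "a = x") auto
    \<comment> \<open>This infimum is shown to be \<open>a\<close>, so that \<open>a\<close> lies in
      \<open>A\<close>. Otherwise \<open>g\<close> and \<open>g'\<close> send it to points of
      \<open>A\<close> above \<open>a\<close>, so neither moves it down, and it is a fixed point of
      \<open>g\<close> in \<open>(a, x]\<close>.\<close>
    let ?c = "Inf (A \<inter> {a<..})"
    have ne: "x \<in> A \<inter> {a<..}" and bdd: "bdd_below (A \<inter> {a<..})" using A(2) \<open>a < x\<close> by auto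
    have "?c \<in> closure (A \<inter> {a<..})"
      using closure_contains_Inf[OF _ bdd] ne by auto
    then have "?c \<in> A"
      using closure_mono[OF Int_lower1, of A "{a<..}"] closure_closed[OF \<open>closed A\<close>] by blast
    have "a \<le> ?c" using ne by (intro cInf_greatest) (blast, simp)
    have "?c \<le> x" using cInf_lower[OF ne bdd] .
    have "?c = a"
    proof (rule ccontr)
      assume "?c \<noteq> a"
      then have "a < ?c" using \<open>a \<le> ?c\<close> by simp
      moreover have "a < g ?c" "a < g' ?c"
        using less_iff[OF g(1), of a ?c] less_iff[OF g(1), of a "g' ?c"] a(1) g' \<open>a < ?c\<close> by auto
      ultimately have "?c \<le> g ?c" "?c \<le> g' ?c"
        using inv[OF g(1) \<open>?c \<in> A\<close>] inv[OF g'(1) \<open>?c \<in> A\<close>] bdd by (auto intro!: cInf_lower)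
      then have "g ?c = ?c" using le_iff[OF g(1), of ?c "g' ?c"] g' by simp
      then show False using a(3)[OF \<open>a < ?c\<close> \<open>?c \<le> x\<close>] by simp
    qed
    then have "x \<in> closure ((\<lambda>f. f a) ` G)"
      using minimal_orbit_dense[OF A(1), of a] \<open>?c \<in> A\<close> A(2) by metis
    \<comment> \<open>Closeness \<open>x - a\<close> puts \<open>h a\<close> above \<open>a\<close>,
      and closeness \<open>d\<close> keeps the stretch between \<open>x\<close> and
      \<open>h a\<close> free of fixed points of \<open>g\<close>. Hence \<open>g\<close> has none
      in \<open>(a, h a]\<close>.\<close>
    moreover have "min d (x - a) > 0" using d \<open>a < x\<close> by simp
    ultimately obtain h where h: "h \<in> G" "dist (h a) x < min d (x - a)"
      unfolding closure_approachable by blast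
    then have ha: "a < h a" "\<bar>h a - x\<bar> < d" by (auto simp: dist_real_def)
    have "g y \<noteq> y" if "a < y" "y \<le> h a" for y
      using that ha a(3)[of y] near[of y] by (cases "y \<le> x") auto
    with ha have "crossed g h" by (intro crossed_above[OF cont[OF g(1)] a(1)])
    then show False using uncrossed g(1) h(1) by blast
  next
    case 2
    then obtain b where b: "g b = b" "x \<le> b" "\<And>y. x \<le> y \<Longrightarrow> y < b \<Longrightarrow> g y \<noteq> y"
      using next_fixed_above[OF g, of x] by (metis less_imp_le)
    then have "x < b" using gx by (cases "x = b") auto
    \<comment> \<open>Mirror image of the first case: \<open>b\<close> lies in \<open>A\<close>, and
      its orbit enters the component from above.\<close>
    let ?c = "Sup (A \<inter> {..<b})"
    have ne: "x \<in> A \<inter> {..<b}" and bdd: "bdd_above (A \<inter> {..<b})" using A(2) \<open>x < b\<close> by auto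
    have "?c \<in> closure (A \<inter> {..<b})"
      using closure_contains_Sup[OF _ bdd] ne by auto
    then have "?c \<in> A"
      using closure_mono[OF Int_lower1, of A "{..<b}"] closure_closed[OF \<open>closed A\<close>] by blast
    have "?c \<le> b" using ne by (intro cSup_least) (blast, simp)
    have "x \<le> ?c" using cSup_upper[OF ne bdd] .
    have "?c = b"
    proof (rule ccontr)
      assume "?c \<noteq> b"
      then have "?c < b" using \<open>?c \<le> b\<close> by simp
      moreover have "g ?c < b" "g' ?c < b"
        using less_iff[OF g(1), of ?c b] less_iff[OF g(1), of "g' ?c" b] b(1) g' \<open>?c < b\<close> by auto
      ultimately have "g ?c \<le> ?c" "g' ?c \<le> ?c"
        using inv[OF g(1) \<open>?c \<in> A\<close>] inv[OF g'(1) \<open>?c \<in> A\<close>] bdd by (auto intro!: cSup_upper)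
      then have "g ?c = ?c" using le_iff[OF g(1), of "g' ?c" ?c] g' by simp
      then show False using b(3)[OF \<open>x \<le> ?c\<close> \<open>?c < b\<close>] by simp
    qed
    then have "x \<in> closure ((\<lambda>f. f b) ` G)"
      using minimal_orbit_dense[OF A(1), of b] \<open>?c \<in> A\<close> A(2) by metis
    moreover have "min d (b - x) > 0" using d \<open>x < b\<close> by simp
    ultimately obtain h where h: "h \<in> G" "dist (h b) x < min d (b - x)"
      unfolding closure_approachable by blast
    then have hb: "h b < b" "\<bar>h b - x\<bar> < d" by (auto simp: dist_real_def)
    have "g y \<noteq> y" if "h b \<le> y" "y < b" for y
      using that hb b(3)[of y] near[of y] by (cases "x \<le> y") auto
    with hb have "crossed g h" by (intro crossed_below[OF cont[OF g(1)] b(1)])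
    then show False using uncrossed g(1) h(1) by blast
  qed
qed

end

section \<open>Stieltjes measures of functions that the group shifts by constants\<close>

context line_group
begin

lemma interval_measure_image:
  assumes F: "mono F" "\<And>a. continuous (at_right a) F"
    and f: "f \<in> G" and shift: "\<And>x. F (f x) = F x + t" and E: "E \<in> sets borel"
  shows "emeasure (interval_measure F) (f ` E) = emeasure (interval_measure F) E"
proof -
  let ?\<mu> = "interval_measure F"
  obtain g where g: "g \<in> G" "\<And>x. f (g x) = x" "\<And>x. g (f x) = x"
    using inverseE[OF f] by metis
  have meas: "g \<in> measurable ?\<mu> borel"
    using borel_measurable_continuous_onI[OF cont[OF g(1)]] by simp
  have vimage: "g -` X = f ` X" for X
  proof
    show "f ` X \<subseteq> g -` X" using g(3) by auto
    show "g -` X \<subseteq> f ` X" using g(2) by (metis image_eqI subsetI vimageE)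
  qed
  have \<nu>: "emeasure (distr ?\<mu> borel g) X = emeasure ?\<mu> (f ` X)" if "X \<in> sets borel" for X
    using emeasure_distr[OF meas] that by (simp add: vimage)
  have Ioc: "emeasure ?\<mu> {a<..b} = (if a \<le> b then F b - F a else 0)" for a b
    using emeasure_interval_measure_Ioc_eq[of F] F by (simp add: monoD)
  let ?E = "range (\<lambda>(a, b). {a<..b::real})"
  have "distr ?\<mu> borel g = ?\<mu>"
  proof (rule measure_eqI_generator_eq[of ?E UNIV])
    show "Int_stable ?E"
    proof (rule Int_stableI)
      fix X Y assume "X \<in> ?E" "Y \<in> ?E"
      then obtain a b c d where "X = {a<..b}" "Y = {c<..d}" by auto
      then have "X \<inter> Y = (\<lambda>(a, b). {a<..b}) (max a c, min b d)" by auto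
      then show "X \<inter> Y \<in> ?E" by blast
    qed
    show "emeasure (distr ?\<mu> borel g) X = emeasure ?\<mu> X" if X_mem: "X \<in> ?E" for X
    proof -
      obtain a b where X: "X = {a<..b}" using X_mem by auto
      then have "emeasure (distr ?\<mu> borel g) X = emeasure ?\<mu> {f a<..f b}"
        using \<nu>[of X] by (simp add: image_Ioc[OF f])
      then show ?thesis by (simp add: X Ioc shift le_iff[OF f])
    qed
    show "sets (distr ?\<mu> borel g) = sigma_sets UNIV ?E" "sets ?\<mu> = sigma_sets UNIV ?E"
      by (simp_all add: borel_sigma_sets_Ioc)
    show "range (\<lambda>n::nat. {- real n<..real n}) \<subseteq> ?E" by auto
    show "(\<Union>n::nat. {- real n<..real n}) = UNIV"
    proof -
      have "\<exists>n. - real n < x \<and> x \<le> real n" for x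
      proof -
        obtain n where "\<bar>x\<bar> < real n" using reals_Archimedean2 by blast
        then show ?thesis by (intro exI[of _ n]) linarith
      qed
      then show ?thesis by auto
    qed
    show "emeasure (distr ?\<mu> borel g) {- real n<..real n} \<noteq> \<infinity>" for n
      by (subst \<nu>) (simp_all add: image_Ioc[OF f] Ioc)
  qed auto
  then show ?thesis using \<nu>[OF E] by simp
qed

lemma radon_interval_measure:
  assumes F: "mono F" "\<And>a. continuous (at_right a) F"
  shows "radon_measure (interval_measure F)"
  unfolding radon_measure_def
proof (intro conjI allI impI)
  fix K :: "real set" assume "compact K"
  then obtain c where c: "\<And>x. x \<in> K \<Longrightarrow> norm x \<le> c"
    using compact_imp_bounded bounded_iff by metis
  \<comment> \<open>The left end is moved by one because a half-open interval starting at
    \<open>- c\<close> would miss that point.\<close>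
  have "K \<subseteq> {- c - 1<..c}"
  proof
    fix x assume "x \<in> K"
    then show "x \<in> {- c - 1<..c}" using c[of x] by auto
  qed
  then have "emeasure (interval_measure F) K \<le> emeasure (interval_measure F) {- c - 1<..c}"
    by (intro emeasure_mono) auto
  also have "\<dots> < \<infinity>"
    using emeasure_interval_measure_Ioc_eq[of F "- c - 1" c] F by (simp add: monoD)
  finally show "emeasure (interval_measure F) K < \<infinity>" .
qed simp

lemma invariant_measure_of_quasi_periodic:
  fixes F :: "real \<Rightarrow> real"
  assumes F: "mono F" "\<And>a. continuous (at_right a) F"
    and shift: "\<And>f. f \<in> G \<Longrightarrow> \<exists>t. \<forall>x. F (f x) = F x + t"
    and ne: "F a < F b"
  shows "\<exists>\<mu>. radon_measure \<mu> \<and> emeasure \<mu> UNIV \<noteq> 0 \<and> invariant_measure G \<mu>"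
proof -
  have "invariant_measure G (interval_measure F)"
    unfolding invariant_measure_def using interval_measure_image[OF F] shift by metis
  moreover have "emeasure (interval_measure F) UNIV \<noteq> 0"
  proof -
    have "a \<le> b" using monoD[OF F(1), of b a] ne by linarith
    then have "emeasure (interval_measure F) {a<..b} > 0"
      using emeasure_interval_measure_Ioc[of a b F] monoD[OF F(1)] F(2) ne by simp
    moreover have "emeasure (interval_measure F) {a<..b} \<le> emeasure (interval_measure F) UNIV"
      by (intro emeasure_mono) auto
    ultimately show ?thesis by auto
  qed
  ultimately show ?thesis
    using radon_interval_measure[OF F] by blast
qed

text \<open>The measure is the Dirac measure at \<open>x\<close>, obtained as the Stieltjes measure of a step function.\<close>

lemma invariant_measure_of_fixed_point:
  assumes fixed: "\<And>f. f \<in> G \<Longrightarrow> f x = x"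
  shows "\<exists>\<mu>. radon_measure \<mu> \<and> emeasure \<mu> UNIV \<noteq> 0 \<and> invariant_measure G \<mu>"
proof (rule invariant_measure_of_quasi_periodic)
  let ?F = "\<lambda>y. if x \<le> y then 1 else 0 :: real"
  show mono: "mono ?F" by (rule monoI) auto
  show "continuous (at_right a) ?F" for a
  proof (subst continuous_at_right_real_increasing)
    show "?F y \<le> ?F z" if "y \<le> z" for y z using monoD[OF mono that] .
    have "a + (x - a) / 2 < x" if "a < x" using that by (simp add: field_simps)
    then show "\<forall>e>0. \<exists>d>0. ?F (a + d) - ?F a < e"
      \<comment> \<open>To the left of \<open>x\<close>, half the distance keeps
        \<open>a + d\<close> before the jump; from \<open>x\<close> on the function is constant and
        any \<open>d\<close> works.\<close>
      by (intro allI impI exI[of _ "if x \<le> a then 1 else (x - a) / 2"]) auto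
  qed
  show "\<exists>t. \<forall>y. ?F (f y) = ?F y + t" if "f \<in> G" for f
    using le_iff[OF that, of x] fixed[OF that] by (intro exI[of _ 0]) auto
  show "?F (x - 1) < ?F x" by simp
qed

end

section \<open>The order on the group, its translation numbers and the invariant measure\<close>

context uncrossed_line_group
begin

text \<open>The quotient \<open>k' \<circ> h\<close> either has a fixed point and then fixes
  \<open>A\<close> pointwise, or has none and moves all points in the same direction. So comparison
  does not depend on the base point in \<open>A\<close>.\<close>

lemma order_on_minimal_set:
  assumes A: "minimal_closed_set G A" "x \<in> A" "y \<in> A"
    and hk: "h \<in> G" "k \<in> G" "h x \<le> k x"
  shows "h y \<le> k y"
proof -
  obtain k' where k': "k' \<in> G" "\<And>x. k (k' x) = x" "\<And>x. k' (k x) = x"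
    using inverseE[OF hk(2)] by metis
  let ?f = "k' \<circ> h"
  have f: "?f \<in> G" using comp_mem hk(1) k'(1) by blast
  have le: "?f z \<le> z \<longleftrightarrow> h z \<le> k z" for z
    using le_iff[OF hk(2), of "?f z" z] k'(2) by simp
  show ?thesis
  proof (cases "\<exists>p. ?f p = p")
    case True
    then have "?f y = y" using fixes_minimal_set[OF A(1,3) f] by blast
    then show ?thesis using le[of y] by simp
  next
    case False
    then have nofix: "?f p \<noteq> p" for p by metis
    have "x < ?f x \<longleftrightarrow> y < ?f y"
    proof (cases "x \<le> y")
      case True
      then show ?thesis by (rule no_sign_change[OF f nofix])
    next
      case False
      then have "y < ?f y \<longleftrightarrow> x < ?f x" by (intro no_sign_change[OF f nofix]) simp
      then show ?thesis by blast
    qed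
    then have "?f x \<le> x \<longleftrightarrow> ?f y \<le> y" by (meson not_le)
    then show ?thesis using hk(3) unfolding le by blast
  qed
qed

lemma ex_translation_number:
  assumes A: "minimal_closed_set G A" "x \<in> A" and g: "g \<in> G" "x < g x"
  shows "\<exists>\<tau>::(real \<Rightarrow> real) \<Rightarrow> real. \<tau> g = 1 \<and>
    (\<forall>h\<in>G. \<forall>k\<in>G. \<tau> (h \<circ> k) = \<tau> h + \<tau> k \<and> (h x \<le> k x \<longrightarrow> \<tau> h \<le> \<tau> k))"
proof -
  let ?G = "homeo_plus\<lparr>carrier := G\<rparr>"
  have simps: "carrier ?G = G" "mult ?G = (\<circ>)" "one ?G = id"
    by (simp_all add: homeo_plus_def)
  have nofix: "g y \<noteq> y" for y
    using fixes_minimal_set[OF A g(1)] g(2) by force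
  have inA: "f x \<in> A" if "f \<in> G" for f
    using that A by (auto simp: minimal_closed_set_def invariant_set_def)
  interpret H: group ?G
    using subgroup.subgroup_is_group[OF subgroup group_homeo_plus] .
  have pow: "g [^]\<^bsub>?G\<^esub> n = g ^^ n" for n :: nat
  proof (induction n)
    case (Suc n)
    then show ?case by (simp add: simps funpow_Suc_right del: funpow.simps)
  qed (simp add: simps)
  interpret H: archimedean_group ?G "\<lambda>h k. h x \<le> k x" g
  proof (unfold_locales, unfold simps)
    fix a b c d assume G: "a \<in> G" "b \<in> G" "c \<in> G" "d \<in> G" and le: "a x \<le> b x" "c x \<le> d x"
    have "a (c x) \<le> a (d x)" using le_iff[OF G(1)] le by simp
    \<comment> \<open>Multiplication on the right moves the base point from \<open>x\<close> to
      \<open>d x\<close>, which is again in \<open>A\<close>.\<close>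
    also have "\<dots> \<le> b (d x)"
      using order_on_minimal_set[OF A inA[OF G(4)] G(1,2) le(1)] .
    finally show "(a \<circ> c) x \<le> (b \<circ> d) x" by simp
  next
    \<comment> \<open>The Archimedean axiom: iterates of the fixed-point-free \<open>g\<close> carry
      \<open>x\<close> beyond any given point.\<close>
    fix h
    obtain n where "h x < (g ^^ n) x"
      using funpow_exceeds[OF g(1) less_imp_le[OF g(2)], of "h x"] nofix by blast
    then show "\<exists>n::nat. h x \<le> (g [^]\<^bsub>?G\<^esub> n) x"
      unfolding pow by (meson less_imp_le)
  qed (use g in auto)
  show ?thesis using H.ex_monotone_hom_to_real unfolding simps .
qed

lemma ex_invariant_measure:
  assumes A: "minimal_closed_set G A"
  shows "\<exists>\<mu>. radon_measure \<mu> \<and> emeasure \<mu> UNIV \<noteq> 0 \<and> invariant_measure G \<mu>"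
proof -
  obtain x where x: "x \<in> A" using A by (auto simp: minimal_closed_set_def)
  show ?thesis
  proof (cases "\<forall>f\<in>G. f x = x")
    case True
    then show ?thesis using invariant_measure_of_fixed_point by blast
  next
    case False
    then obtain f where f: "f \<in> G" "f x \<noteq> x" by blast
    obtain g where g: "g \<in> G" "x < g x"
    proof (cases "x < f x")
      case True
      then show ?thesis using that f by blast
    next
      case False
      obtain f' where f': "f' \<in> G" "\<And>x. f (f' x) = x" using inverseE[OF f(1)] by metis
      have "x < f' x" using less_iff[OF f(1), of x "f' x"] f' f(2) False by simp
      then show ?thesis using that f' by blast
    qed
    have nofix: "g y \<noteq> y" for y
      using fixes_minimal_set[OF A x g(1)] g(2) by force
    obtain g' where g': "g' \<in> G" "\<And>x. g (g' x) = x" "\<And>x. g' (g x) = x"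
      using inverseE[OF g(1)] by metis
    have nofix': "g' y \<noteq> y" for y using nofix g'(2)[of y] by metis
    have "g' x \<le> x" using le_iff[OF g(1), of "g' x" x] g g' by simp
    obtain \<tau> :: "(real \<Rightarrow> real) \<Rightarrow> real" where \<tau>: "\<tau> g = 1"
      "\<And>h k. h \<in> G \<Longrightarrow> k \<in> G \<Longrightarrow> \<tau> (h \<circ> k) = \<tau> h + \<tau> k"
      "\<And>h k. h \<in> G \<Longrightarrow> k \<in> G \<Longrightarrow> h x \<le> k x \<Longrightarrow> \<tau> h \<le> \<tau> k"
      using ex_translation_number[OF A x g] by blast
    define S where "S y = \<tau> ` {h \<in> G. y < h x}" for y
    define F where "F y = Inf (S y)" for y
    have mem_S: "\<tau> h \<in> S y" if "h \<in> G" "y < h x" for h y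
      using that by (auto simp: S_def)
    have ne: "S y \<noteq> {}" for y
    proof -
      obtain n where "y < (g ^^ n) x"
        using funpow_exceeds[OF g(1) less_imp_le[OF g(2)], of y] nofix by blast
      then show ?thesis using mem_S[OF funpow_mem[OF g(1)]] by blast
    qed
    have bdd: "bdd_below (S y)" for y
    proof -
      \<comment> \<open>An iterate of the inverse of \<open>g\<close> that takes \<open>x\<close>
        below \<open>y\<close> is smaller than every \<open>h\<close> counted in \<open>S y\<close>;
        its \<open>\<tau>\<close> is the lower bound.\<close>
      obtain n where n: "(g' ^^ n) x < y"
        using funpow_falls_below[OF g'(1) \<open>g' x \<le> x\<close>, of y] nofix' by blast
      have "\<tau> (g' ^^ n) \<le> \<tau> h" if "h \<in> G" "y < h x" for h
        using that n by (intro \<tau>(3) funpow_mem g') auto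
      then show ?thesis by (intro bdd_belowI[of _ "\<tau> (g' ^^ n)"]) (auto simp: S_def)
    qed
    have "mono F"
    proof (rule monoI)
      fix y z :: real assume "y \<le> z"
      then have "S z \<subseteq> S y" by (auto simp: S_def)
      then show "F y \<le> F z" unfolding F_def using ne bdd by (intro cInf_superset_mono)
    qed
    have rc: "continuous (at_right a) F" for a
    proof (subst continuous_at_right_real_increasing)
      show "F y \<le> F z" if "y \<le> z" for y z using \<open>mono F\<close> that by (rule monoD)
      show "\<forall>e>0. \<exists>d>0. F (a + d) - F a < e"
      proof (intro allI impI)
        fix e :: real assume "e > 0"
        then have "Inf (S a) < F a + e" by (simp add: F_def)
        then obtain h where h: "h \<in> G" "a < h x" "\<tau> h < F a + e"
          using cInf_lessD[OF ne] by (auto simp: S_def)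
        let ?d = "(h x - a) / 2"
        have "a + ?d < h x" using h(2) by (simp add: field_simps)
        then have "F (a + ?d) \<le> \<tau> h"
          unfolding F_def by (intro cInf_lower bdd mem_S h(1))
        then show "\<exists>d>0. F (a + d) - F a < e" using h by (intro exI[of _ ?d]) simp
      qed
    qed
    have shift_le: "F (k y) \<le> F y + \<tau> k" if k: "k \<in> G" for k y
    proof -
      have "F (k y) - \<tau> k \<le> Inf (S y)"
      proof (rule cInf_greatest[OF ne])
        fix t assume "t \<in> S y"
        then obtain h where h: "h \<in> G" "y < h x" "t = \<tau> h" by (auto simp: S_def)
        have "F (k y) \<le> \<tau> (k \<circ> h)"
          unfolding F_def using h less_iff[OF k]
          by (intro cInf_lower bdd mem_S comp_mem k) auto
        then show "F (k y) - \<tau> k \<le> t" using \<tau>(2)[OF k h(1)] h(3) by simp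
      qed
      then show ?thesis by (simp add: F_def)
    qed
    have shift: "F (k y) = F y + \<tau> k" if k: "k \<in> G" for k y
    proof -
      obtain k' where k': "k' \<in> G" "\<And>x. k (k' x) = x" "\<And>x. k' (k x) = x"
        using inverseE[OF k] by metis
      have "\<tau> id = 0" using \<tau>(2)[OF id_mem id_mem] by simp
      moreover have "k \<circ> k' = id" using k'(2) by (simp add: fun_eq_iff)
      ultimately have "\<tau> k + \<tau> k' = 0" using \<tau>(2)[OF k k'(1)] by simp
      then show ?thesis
        \<comment> \<open>The reverse inequality is \<open>shift_le\<close> for the inverse of
          \<open>k\<close> at \<open>k y\<close>, since
          \<open>\<tau> k' = - \<tau> k\<close>.\<close>
        using shift_le[OF k, of y] shift_le[OF k'(1), of "k y"] k'(3)[of y] by simp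
    qed
    have "F x < F (g x)" using shift[OF g(1)] \<tau>(1) by simp
    then show ?thesis
      using invariant_measure_of_quasi_periodic[OF \<open>mono F\<close> rc] shift by blast
  qed
qed

end

section \<open>The equivalence\<close>

theorem theorem1p3:
  fixes G :: "(real \<Rightarrow> real) set"
  assumes "subgroup G homeo_plus"
    and "\<forall>f\<in>G. \<forall>g\<in>G. \<not> crossed f g"
  shows "((\<exists>\<mu>. radon_measure \<mu> \<and> emeasure \<mu> UNIV \<noteq> 0 \<and> invariant_measure G \<mu>)
            \<longleftrightarrow> (\<exists>A. minimal_closed_set G A))
       \<and> ((\<exists>A. minimal_closed_set G A)
            \<longleftrightarrow> \<not> (\<exists>a b f. infinite_tower a b f \<and> (\<forall>i. f i \<in> G) \<and> (\<Union>i. {a i..b i}) = UNIV))"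
proof -
  interpret uncrossed_line_group G
    using assms by (auto intro!: uncrossed_line_group.intro line_group.intro uncrossed_line_group_axioms.intro)
  let ?measure = "\<exists>\<mu>. radon_measure \<mu> \<and> emeasure \<mu> UNIV \<noteq> 0 \<and> invariant_measure G \<mu>"
  let ?minimal = "\<exists>A. minimal_closed_set G A"
  let ?tower = "\<exists>a b f. infinite_tower a b f \<and> (\<forall>i. f i \<in> G) \<and> (\<Union>i. {a i..b i}) = UNIV"
  have "\<not> ?tower" if ?measure
    using that tower_null by metis
  moreover have ?minimal if "\<not> ?tower"
    using that ex_tower by argo
  moreover have ?measure if ?minimal
    using that ex_invariant_measure by (elim exE)
  ultimately show ?thesis by argo
qed

end
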